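(* For any Poisson-Ore variety $(X,\pi_X,\mathcal A_X)$, all the coordinate functions in any coordinate chart $\rho:Z\to\rho(Z)\subset X$ in $\mathcal A_X$ have complete Hamiltonian flows with Property $\mathcal Q$ in $\rho(Z)$.
   Context: All varieties are assumed smooth. **Poisson CGL extensions.** Let $\mathbb T$ be a split $\mathbb C$-torus with Lie algebra $\mathfrak t$ and character group $X(\mathbb T)$; characters are also regarded as elements of $\mathfrak t^*$ via differentials. A $\mathbb T$-Poisson algebra is a Poisson algebra over $\mathbb C$ with a rational $\mathbb T$-action by Poisson automorphisms. For a $\mathbb T$-Poisson algebra $R$ that is an integral domain, a $\mathbb T$-homogeneous Poisson prime element is a prime element $r\in R$ that is a $\mathbb T$-weight vector with $\{r,R\}\subset rR$. A symmetric $\mathbb T$-Poisson CGL extension of length $n$ is a pair $(R,\mathcal D)$ where $R=(\mathbb C[z_1,\ldots,z_n],\{\,,\})$ is a polynomial Poisson algebra and $\mathcal D=(\chi_1,\ldots,\chi_n,h_1,\ldots,h_n,h'_1,\ldots,h'_n)$ (the $\mathbb T$-action data) with $\chi_j\in X(\mathbb T)$, $h_j,h'_j\in\mathfrak t$, $\chi_j(h_j)\ne0$, $\chi_j(h'_j)\neq0$ for all $j$, such that for all $1\le i<j\le n$ $$\{z_i,z_j\}=-\chi_i(h_j)z_iz_j-f_{i,j}=\chi_j(h'_i)z_iz_j-f_{i,j}\quad\text{for some } f_{i,j}\in\mathbb C[z_{i+1},\ldots,z_{j-1}],$$ and such that the $\mathbb T$-action by algebra automorphisms with $t\cdot z_j=t^{\chi_j}z_j$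 preserves $\{\,,\}$. A localized symmetric $\mathbb T$-Poisson CGL extension is a pair $(R,\mathcal D)$ with $R=(\mathbb C[z_1,\ldots,z_n][y_1^{-1},\ldots,y_k^{-1}],\{\,,\})$, where $((\mathbb C[z_1,\ldots,z_n],\{\,,\}),\mathcal D)$ is a symmetric $\mathbb T$-Poisson CGL extension and $y_1,\ldots,y_k$ are $\mathbb T$-homogeneous Poisson prime elements of $\mathbb C[z_1,\ldots,z_n]$ (possibly $k=0$). A presentation of a $\mathbb T$-Poisson algebra $P$ as a localized symmetric $\mathbb T'$-Poisson CGL extension is a triple $((R,\mathcal D),E,I)$ with $(R,\mathcal D)$ a localized symmetric $\mathbb T'$-Poisson CGL extension, $E:\mathbb T\to\mathbb T'$ an embedding of split $\mathbb C$-tori, and $I:P\to R$ an isomorphism of $\mathbb T$-Poisson algebras, $\mathbb T$ acting on $R$ through $E$. **Poisson-Ore varieties.** Let $(X,\pi_X)$ be an $n$-dimensional irreducible $\mathbb T$-Poisson variety, i.e. a Poisson variety with an algebraic $\mathbb T$-action preserving $\pi_X$; the induced action on functions is $(t\cdot f)(x)=f(t\cdot x)$. If $X'\subset X$ is a $\mathbb T$-invariant Zariski open subset and $\rho:Z\to X'$ is a parametrization by a Zariski open $Z\subset\mathbb C^n$, then $\pi_X$ is presented as a localized symmetric Poisson CGL extension in the chart $\rho$ if there are a split $\mathbb C$-torus $\mathbb T'$, an embedding $E:\mathbb T\to\mathbb T'$ and $\mathbb T'$-action data $\mathcal D$ such that $((\mathbb C[Z],\mathcal D),E,\rho^*:\mathbb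 C[X']\to\mathbb C[Z])$ is a presentation of the $\mathbb T$-Poisson algebra $(\mathbb C[X'],\pi_X)$ as a localized symmetric $\mathbb T'$-Poisson CGL extension. A $\mathbb T$-Poisson-Ore atlas for $(X,\pi_X)$ is an atlas $\mathcal A_X$ of $\mathbb T$-invariant coordinate charts parametrized by Zariski open subsets of $\mathbb C^n$ such that $\pi_X$ is presented as a localized symmetric Poisson CGL extension in each chart. A $\mathbb T$-Poisson-Ore variety is a triple $(X,\pi_X,\mathcal A_X)$ with $(X,\pi_X)$ an irreducible rational $\mathbb T$-Poisson variety and $\mathcal A_X$ a $\mathbb T$-Poisson-Ore atlas for it. A Poisson-Ore variety is a $\mathbb T$-Poisson-Ore variety for some split $\mathbb C$-torus $\mathbb T$. **Property $\mathcal Q$.** Let $\mathcal Q$ be the algebra of quasi-polynomials: holomorphic functions on $\mathbb C$ of the form $\gamma(c)=\sum_{k=1}^Nq_k(c)e^{a_kc}$ with $q_k\in\mathbb C[c]$ and $a_k\in\mathbb C$ pairwise distinct. A holomorphic curve $\gamma:\mathbb C\to Y$ in a smooth affine complex variety $Y$ has Property $\mathcal Q$ if for some (equivalently, every) embedding $I:Y\hookrightarrow\mathbb C^m$ as an affine subvariety all components of $I\circ\gamma$ are in $\mathcal Q$. For a smooth affine complex Poisson variety $(Y,\pi)$, a function $f\in\mathbb C[Y]$ has complete Hamiltonian flow with Property $\mathcal Q$ (in $Y$) if all integral curves of its Hamiltonian vector field $H_f$, $H_f(f_1)=\pi(df,df_1)$, are defined over $\mathbb C$ and have Property $\mathcal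 Q$. Here $Y=\rho(Z)$, and the coordinate functions in the chart $\rho$ are the compositions of $\rho^{-1}$ with the standard coordinate functions of $\mathbb C^n$ restricted to $Z$.
   Formalization: The parameter sets Z of the charts are assumed affine: Property Q is defined only on affine ρ(Z), and for Z = C² minus the origin with {z1,z2} = a z1 z2 + c (a, c nonzero) the flow of z1 is not complete. *)

theory Defs
  imports
    "HOL-Analysis.Analysis"
    "HOL-Algebra.Ring_Divisibility"
    "HOL-Computational_Algebra.Polynomial"
begin

section \<open>Varieties over the complex numbers\<close>

text \<open>
  Varieties are spaces with functions in the sense of Serre: a set of closed points with its Zariski
  topology and, for each open set, the regular functions on it. A regular function on \<open>U\<close> is
  a total function of which only the values on \<open>U\<close> matter; all identities between regular
  functions on \<open>U\<close> are therefore stated pointwise on \<open>U\<close>.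
\<close>

record 'a fspace =
  ztop :: "'a topology"
  reg :: "'a set \<Rightarrow> ('a \<Rightarrow> complex) set"

abbreviation points :: "'a fspace \<Rightarrow> 'a set" where
  "points X \<equiv> topspace (ztop X)"

definition feq :: "'p set \<Rightarrow> ('p \<Rightarrow> complex) \<Rightarrow> ('p \<Rightarrow> complex) \<Rightarrow> bool" where
  "feq S f g \<longleftrightarrow> (\<forall>x\<in>S. f x = g x)"

definition function_algebra :: "'p set \<Rightarrow> ('p \<Rightarrow> complex) set \<Rightarrow> bool" where
  "function_algebra S A \<longleftrightarrow>
     (\<forall>c. (\<lambda>_. c) \<in> A) \<and>
     (\<forall>f\<in>A. \<forall>g\<in>A. (\<lambda>x. f x + g x) \<in> A \<and> (\<lambda>x. f x * g x) \<in> A) \<and>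
     (\<forall>f\<in>A. \<forall>g. feq S f g \<longrightarrow> g \<in> A)"

definition space_with_functions :: "'a fspace \<Rightarrow> bool" where
  "space_with_functions X \<longleftrightarrow>
     (\<forall>U. openin (ztop X) U \<longrightarrow> function_algebra U (reg X U)) \<and>
     (\<forall>U V. openin (ztop X) U \<and> openin (ztop X) V \<and> V \<subseteq> U \<longrightarrow> reg X U \<subseteq> reg X V) \<and>
     (\<forall>U f. openin (ztop X) U \<and>
        (\<forall>x\<in>U. \<exists>V. openin (ztop X) V \<and> x \<in> V \<and> V \<subseteq> U \<and> (\<exists>g\<in>reg X V. feq V f g))
        \<longrightarrow> f \<in> reg X U)"

definition morphism :: "'a fspace \<Rightarrow> 'b fspace \<Rightarrow> ('a \<Rightarrow> 'b) \<Rightarrow> bool" where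
  "morphism X Y \<phi> \<longleftrightarrow>
     continuous_map (ztop X) (ztop Y) \<phi> \<and>
     (\<forall>V g. openin (ztop Y) V \<and> g \<in> reg Y V \<longrightarrow> g \<circ> \<phi> \<in> reg X {x \<in> points X. \<phi> x \<in> V})"

definition isomorphism :: "'a fspace \<Rightarrow> 'b fspace \<Rightarrow> ('a \<Rightarrow> 'b) \<Rightarrow> bool" where
  "isomorphism X Y \<phi> \<longleftrightarrow>
     morphism X Y \<phi> \<and>
     (\<exists>\<psi>. morphism Y X \<psi> \<and> (\<forall>x\<in>points X. \<psi> (\<phi> x) = x) \<and> (\<forall>y\<in>points Y. \<phi> (\<psi> y) = y))"

text \<open>The structure induced on a subset: functions that locally extend to regular functions of
  the ambient space.\<close>

definition sub_fspace :: "'a fspace \<Rightarrow> 'a set \<Rightarrow> 'a fspace" where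
  "sub_fspace X S =
     \<lparr>ztop = subtopology (ztop X) S,
      reg = (\<lambda>V. {f. \<forall>x\<in>V. \<exists>U. openin (ztop X) U \<and> x \<in> U \<and> (\<exists>g\<in>reg X U. feq (U \<inter> V) f g)})\<rparr>"

definition closed_embedding :: "'a fspace \<Rightarrow> 'b fspace \<Rightarrow> ('a \<Rightarrow> 'b) \<Rightarrow> bool" where
  "closed_embedding X Y \<phi> \<longleftrightarrow>
     closedin (ztop Y) (\<phi> ` points X) \<and> isomorphism X (sub_fspace Y (\<phi> ` points X)) \<phi>"

subsection \<open>Affine space\<close>

text \<open>Points of affine \<open>n\<close>-space are sequences supported in \<open>{..<n}\<close>; coordinates are
  indexed from \<open>0\<close>.\<close>

definition cspace :: "nat \<Rightarrow> (nat \<Rightarrow> complex) set" where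
  "cspace n = {x. \<forall>i\<ge>n. x i = 0}"

text \<open>The polynomial ring in the variables with index in \<open>I\<close>. Since the complex
  numbers are infinite, polynomials are identified with polynomial functions.\<close>

inductive_set polys :: "nat set \<Rightarrow> ((nat \<Rightarrow> complex) \<Rightarrow> complex) set" for I :: "nat set" where
  const: "(\<lambda>_. c) \<in> polys I"
| var: "i \<in> I \<Longrightarrow> (\<lambda>x. x i) \<in> polys I"
| add: "p \<in> polys I \<Longrightarrow> q \<in> polys I \<Longrightarrow> (\<lambda>x. p x + q x) \<in> polys I"
| mult: "p \<in> polys I \<Longrightarrow> q \<in> polys I \<Longrightarrow> (\<lambda>x. p x * q x) \<in> polys I"

definition poly_ring :: "nat \<Rightarrow> ((nat \<Rightarrow> complex) \<Rightarrow> complex) ring" where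
  "poly_ring n =
     \<lparr>carrier = polys {..<n}, mult = (\<lambda>f g x. f x * g x), one = (\<lambda>_. 1),
      zero = (\<lambda>_. 0), add = (\<lambda>f g x. f x + g x)\<rparr>"

definition zariski_open :: "nat \<Rightarrow> (nat \<Rightarrow> complex) set \<Rightarrow> bool" where
  "zariski_open n U \<longleftrightarrow> (\<exists>S \<subseteq> polys {..<n}. U = {x \<in> cspace n. \<exists>p\<in>S. p x \<noteq> 0})"

definition zariski :: "nat \<Rightarrow> (nat \<Rightarrow> complex) topology" where
  "zariski n = topology (zariski_open n)"

lemma istopology_zariski_open: "istopology (zariski_open n)"
  unfolding istopology_def
proof (intro conjI allI impI)
  fix U V assume "zariski_open n U" "zariski_open n V"
  then obtain S T where S: "S \<subseteq> polys {..<n}" "U = {x \<in> cspace n. \<exists>p\<in>S. p x \<noteq> 0}"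
    and T: "T \<subseteq> polys {..<n}" "V = {x \<in> cspace n. \<exists>p\<in>T. p x \<noteq> 0}"
    unfolding zariski_open_def by blast
  define M where "M = {\<lambda>x. p x * q x | p q. p \<in> S \<and> q \<in> T}"
  have "M \<subseteq> polys {..<n}"
  proof
    fix r assume "r \<in> M"
    then obtain p q where r: "r = (\<lambda>x. p x * q x)" and "p \<in> S" "q \<in> T" unfolding M_def by blast
    hence "p \<in> polys {..<n}" "q \<in> polys {..<n}" using S(1) T(1) by blast+
    thus "r \<in> polys {..<n}" unfolding r by (rule polys.mult)
  qed
  moreover have "U \<inter> V = {x \<in> cspace n. \<exists>p\<in>M. p x \<noteq> 0}"
  proof (intro equalityI subsetI)
    fix x assume "x \<in> U \<inter> V"
    then obtain p q where pq: "x \<in> cspace n" "p \<in> S" "q \<in> T" "p x \<noteq> 0" "q x \<noteq> 0"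
      unfolding S(2) T(2) by blast
    define r where "r = (\<lambda>x. p x * q x)"
    have "r \<in> M" unfolding M_def r_def using pq(2,3) by blast
    moreover have "r x \<noteq> 0" using pq(4,5) by (simp add: r_def)
    ultimately show "x \<in> {x \<in> cspace n. \<exists>p\<in>M. p x \<noteq> 0}" using pq(1) by blast
  next
    fix x assume "x \<in> {x \<in> cspace n. \<exists>p\<in>M. p x \<noteq> 0}"
    then obtain r where x: "x \<in> cspace n" and r: "r \<in> M" "r x \<noteq> 0" by blast
    from r(1) obtain p q where "r = (\<lambda>x. p x * q x)" "p \<in> S" "q \<in> T" unfolding M_def by blast
    with x r(2) show "x \<in> U \<inter> V" unfolding S(2) T(2) by auto
  qed
  ultimately show "zariski_open n (U \<inter> V)" unfolding zariski_open_def by blast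
next
  fix K assume K: "\<forall>U\<in>K. zariski_open n U"
  let ?S = "{p \<in> polys {..<n}. \<forall>x\<in>cspace n. p x \<noteq> 0 \<longrightarrow> x \<in> \<Union>K}"
  have "\<Union>K = {x \<in> cspace n. \<exists>p\<in>?S. p x \<noteq> 0}"
  proof (intro equalityI subsetI)
    fix x assume "x \<in> \<Union>K"
    then obtain U where U: "U \<in> K" "x \<in> U" by blast
    then obtain S where S: "S \<subseteq> polys {..<n}" "U = {x \<in> cspace n. \<exists>p\<in>S. p x \<noteq> 0}"
      using K unfolding zariski_open_def by meson
    then obtain p where p: "x \<in> cspace n" "p \<in> S" "p x \<noteq> 0" using U(2) by blast
    have "p \<in> ?S"
    proof (intro CollectI conjI ballI impI)
      show "p \<in> polys {..<n}" using S(1) p(2) by blast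
      fix y assume "y \<in> cspace n" "p y \<noteq> 0"
      hence "y \<in> U" using S(2) p(2) by blast
      thus "y \<in> \<Union>K" using U(1) by blast
    qed
    thus "x \<in> {x \<in> cspace n. \<exists>p\<in>?S. p x \<noteq> 0}" using p by blast
  qed blast
  moreover have "?S \<subseteq> polys {..<n}" by (rule Collect_restrict)
  ultimately show "zariski_open n (\<Union>K)" unfolding zariski_open_def by (intro exI[of _ ?S] conjI)
qed

lemma openin_zariski: "openin (zariski n) = zariski_open n"
  unfolding zariski_def by (rule topology_inverse'[OF istopology_zariski_open])

lemma topspace_zariski: "topspace (zariski n) = cspace n"
proof
  show "topspace (zariski n) \<subseteq> cspace n"
    unfolding topspace_def openin_zariski zariski_open_def by blast
  have "zariski_open n (cspace n)"
    unfolding zariski_open_def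
  proof (intro exI conjI)
    show "{\<lambda>_. 1 :: complex} \<subseteq> polys {..<n}" using polys.const by simp
    show "cspace n = {x \<in> cspace n. \<exists>p\<in>{\<lambda>_. 1 :: complex}. p x \<noteq> 0}" by simp
  qed
  hence "openin (zariski n) (cspace n)" unfolding openin_zariski .
  thus "cspace n \<subseteq> topspace (zariski n)" by (rule openin_subset)
qed

definition affine_space :: "nat \<Rightarrow> (nat \<Rightarrow> complex) fspace" where
  "affine_space n =
     \<lparr>ztop = zariski n,
      reg = (\<lambda>U. {f. \<forall>x\<in>U. \<exists>V p q. openin (zariski n) V \<and> x \<in> V \<and> V \<subseteq> U \<and>
                p \<in> polys {..<n} \<and> q \<in> polys {..<n} \<and> (\<forall>y\<in>V. q y \<noteq> 0 \<and> f y = p y / q y)})\<rparr>"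

definition affine_variety :: "'a fspace \<Rightarrow> bool" where
  "affine_variety X \<longleftrightarrow> (\<exists>m \<phi>. closed_embedding X (affine_space m) \<phi>)"

subsection \<open>Products\<close>

definition tensor_functions ::
  "'a fspace \<Rightarrow> 'b fspace \<Rightarrow> 'a set \<Rightarrow> 'b set \<Rightarrow> ('a \<times> 'b \<Rightarrow> complex) set" where
  "tensor_functions X Y U V =
     {h. \<exists>k f g. (\<forall>i<k. f i \<in> reg X U \<and> g i \<in> reg Y V) \<and>
          (\<forall>x\<in>U. \<forall>y\<in>V. h (x, y) = (\<Sum>i<(k::nat). f i x * g i y))}"

text \<open>The product of varieties, which does not carry the product topology.\<close>

definition prod_zariski :: "'a fspace \<Rightarrow> 'b fspace \<Rightarrow> ('a \<times> 'b) topology" where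
  "prod_zariski X Y = topology_generated_by
     {{w \<in> U \<times> V. h w \<noteq> 0} | U V h.
        openin (ztop X) U \<and> openin (ztop Y) V \<and> h \<in> tensor_functions X Y U V}"

definition prod_fspace :: "'a fspace \<Rightarrow> 'b fspace \<Rightarrow> ('a \<times> 'b) fspace" where
  "prod_fspace X Y =
     \<lparr>ztop = prod_zariski X Y,
      reg = (\<lambda>W. {F. \<forall>w\<in>W. \<exists>U V W' p q. openin (ztop X) U \<and> openin (ztop Y) V \<and>
                openin (prod_zariski X Y) W' \<and> w \<in> W' \<and> W' \<subseteq> W \<inter> U \<times> V \<and>
                p \<in> tensor_functions X Y U V \<and> q \<in> tensor_functions X Y U V \<and>
                (\<forall>v\<in>W'. q v \<noteq> 0 \<and> F v = p v / q v)})\<rparr>"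

subsection \<open>Smooth irreducible rational varieties\<close>

definition separated :: "'a fspace \<Rightarrow> bool" where
  "separated X \<longleftrightarrow> closedin (ztop (prod_fspace X X)) {(x, x) | x. x \<in> points X}"

definition variety :: "'a fspace \<Rightarrow> bool" where
  "variety X \<longleftrightarrow>
     space_with_functions X \<and> separated X \<and>
     (\<exists>\<U>. finite \<U> \<and> \<Union>\<U> = points X \<and>
        (\<forall>U\<in>\<U>. openin (ztop X) U \<and> affine_variety (sub_fspace X U)))"

definition irreducible_in :: "'a topology \<Rightarrow> 'a set \<Rightarrow> bool" where
  "irreducible_in \<tau> S \<longleftrightarrow>
     S \<noteq> {} \<and> S \<subseteq> topspace \<tau> \<and>
     (\<forall>A B. closedin \<tau> A \<and> closedin \<tau> B \<and> S \<subseteq> A \<union> B \<longrightarrow> S \<subseteq> A \<or> S \<subseteq> B)"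

definition irreducible_chain :: "'a topology \<Rightarrow> nat \<Rightarrow> bool" where
  "irreducible_chain \<tau> n \<longleftrightarrow>
     (\<exists>C. (\<forall>i\<le>n. closedin \<tau> (C i) \<and> irreducible_in \<tau> (C i)) \<and> (\<forall>i<n. C i \<subset> C (Suc i)))"

definition has_dimension :: "'a fspace \<Rightarrow> nat \<Rightarrow> bool" where
  "has_dimension X n \<longleftrightarrow> irreducible_chain (ztop X) n \<and> \<not> irreducible_chain (ztop X) (Suc n)"

text \<open>Point derivations of the local ring at \<open>x\<close>, applied to representatives \<open>(U, f)\<close> of
  germs and set to \<open>0\<close> on pairs which do not represent a germ at \<open>x\<close>.\<close>

definition tangent_space :: "'a fspace \<Rightarrow> 'a \<Rightarrow> ('a set \<Rightarrow> ('a \<Rightarrow> complex) \<Rightarrow> complex) set" where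
  "tangent_space X x =
     (let germ = (\<lambda>U f. openin (ztop X) U \<and> x \<in> U \<and> f \<in> reg X U) in
      {v. (\<forall>U f. \<not> germ U f \<longrightarrow> v U f = 0) \<and>
          (\<forall>U V W f g. germ U f \<and> germ V g \<and> openin (ztop X) W \<and> x \<in> W \<and> W \<subseteq> U \<inter> V \<and> feq W f g
             \<longrightarrow> v U f = v V g) \<and>
          (\<forall>U f g a b. germ U f \<and> germ U g
             \<longrightarrow> v U (\<lambda>y. a * f y + b * g y) = a * v U f + b * v U g) \<and>
          (\<forall>U f g. germ U f \<and> germ U g
             \<longrightarrow> v U (\<lambda>y. f y * g y) = f x * v U g + g x * v U f)})"

text \<open>An irreducible variety of dimension \<open>n\<close> is smooth if all its tangent spaces have
  a basis of \<open>n\<close> elements.\<close>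

definition smooth_of_dim :: "'a fspace \<Rightarrow> nat \<Rightarrow> bool" where
  "smooth_of_dim X n \<longleftrightarrow>
     (\<forall>x\<in>points X. \<exists>e. (\<forall>i<n. e i \<in> tangent_space X x) \<and>
        (\<forall>v\<in>tangent_space X x. \<exists>!c. c \<in> cspace n \<and> v = (\<lambda>U f. \<Sum>i<n. c i * e i U f)))"

definition rational_variety :: "'a fspace \<Rightarrow> nat \<Rightarrow> bool" where
  "rational_variety X n \<longleftrightarrow>
     (\<exists>U W \<phi>. openin (ztop X) U \<and> U \<noteq> {} \<and> openin (zariski n) W \<and> W \<noteq> {} \<and>
        isomorphism (sub_fspace X U) (sub_fspace (affine_space n) W) \<phi>)"

section \<open>Split tori\<close>

text \<open>A split torus is given as \<open>d\<close>-fold product of the multiplicative group; its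
  multiplication is pointwise (entries with index at least \<open>d\<close> are \<open>0\<close>).\<close>

definition torus :: "nat \<Rightarrow> (nat \<Rightarrow> complex) set" where
  "torus d = {t \<in> cspace d. \<forall>i<d. t i \<noteq> 0}"

definition tone :: "nat \<Rightarrow> nat \<Rightarrow> complex" where
  "tone d = (\<lambda>i. if i < d then 1 else 0)"

definition tmult :: "(nat \<Rightarrow> complex) \<Rightarrow> (nat \<Rightarrow> complex) \<Rightarrow> nat \<Rightarrow> complex" where
  "tmult s t = (\<lambda>i. s i * t i)"

definition torus_variety :: "nat \<Rightarrow> (nat \<Rightarrow> complex) fspace" where
  "torus_variety d = sub_fspace (affine_space d) (torus d)"

definition torus_character :: "nat \<Rightarrow> ((nat \<Rightarrow> complex) \<Rightarrow> complex) \<Rightarrow> bool" where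
  "torus_character d \<xi> \<longleftrightarrow>
     \<xi> \<in> reg (torus_variety d) (torus d) \<and>
     (\<forall>t\<in>torus d. \<xi> t \<noteq> 0) \<and>
     (\<forall>s\<in>torus d. \<forall>t\<in>torus d. \<xi> (tmult s t) = \<xi> s * \<xi> t)"

text \<open>The Lie algebra is \<open>cspace d\<close> with the componentwise exponential map; this is the
  value on \<open>h\<close> of the differential of \<open>\<xi>\<close> at the identity.\<close>

definition char_pairing :: "nat \<Rightarrow> ((nat \<Rightarrow> complex) \<Rightarrow> complex) \<Rightarrow> (nat \<Rightarrow> complex) \<Rightarrow> complex" where
  "char_pairing d \<xi> h = deriv (\<lambda>s. \<xi> (\<lambda>i. if i < d then exp (s * h i) else 0)) 0"

definition torus_embedding :: "nat \<Rightarrow> nat \<Rightarrow> ((nat \<Rightarrow> complex) \<Rightarrow> nat \<Rightarrow> complex) \<Rightarrow> bool" where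
  "torus_embedding d d' E \<longleftrightarrow>
     closed_embedding (torus_variety d) (torus_variety d') E \<and>
     (\<forall>s\<in>torus d. \<forall>t\<in>torus d. E (tmult s t) = tmult (E s) (E t))"

section \<open>Poisson algebras with torus action\<close>

text \<open>Commutative algebras are realised as algebras \<open>A\<close> of functions on a set \<open>S\<close>,
  with functions that agree on \<open>S\<close> being identified.\<close>

definition poisson_algebra ::
  "'p set \<Rightarrow> ('p \<Rightarrow> complex) set \<Rightarrow> (('p \<Rightarrow> complex) \<Rightarrow> ('p \<Rightarrow> complex) \<Rightarrow> 'p \<Rightarrow> complex) \<Rightarrow> bool" where
  "poisson_algebra S A br \<longleftrightarrow>
     function_algebra S A \<and>
     (\<forall>f\<in>A. \<forall>g\<in>A. br f g \<in> A) \<and>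
     (\<forall>f\<in>A. \<forall>f'\<in>A. \<forall>g\<in>A. \<forall>g'\<in>A. feq S f f' \<and> feq S g g' \<longrightarrow> feq S (br f g) (br f' g')) \<and>
     (\<forall>f\<in>A. \<forall>g\<in>A. feq S (br f g) (\<lambda>x. - br g f x)) \<and>
     (\<forall>f\<in>A. \<forall>g\<in>A. \<forall>k\<in>A. \<forall>a b.
        feq S (br k (\<lambda>x. a * f x + b * g x)) (\<lambda>x. a * br k f x + b * br k g x)) \<and>
     (\<forall>f\<in>A. \<forall>g\<in>A. \<forall>k\<in>A. feq S (br k (\<lambda>x. f x * g x)) (\<lambda>x. br k f x * g x + f x * br k g x)) \<and>
     (\<forall>f\<in>A. \<forall>g\<in>A. \<forall>k\<in>A.
        feq S (\<lambda>x. br f (br g k) x + br g (br k f) x + br k (br f g) x) (\<lambda>_. 0))"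

record 'p tp_alg =
  pts :: "'p set"
  elts :: "('p \<Rightarrow> complex) set"
  brk :: "('p \<Rightarrow> complex) \<Rightarrow> ('p \<Rightarrow> complex) \<Rightarrow> 'p \<Rightarrow> complex"
  tact :: "(nat \<Rightarrow> complex) \<Rightarrow> ('p \<Rightarrow> complex) \<Rightarrow> 'p \<Rightarrow> complex"

definition T_action_by_automorphisms :: "nat \<Rightarrow> 'p tp_alg \<Rightarrow> bool" where
  "T_action_by_automorphisms d R \<longleftrightarrow>
     (\<forall>f\<in>elts R. feq (pts R) (tact R (tone d) f) f) \<and>
     (\<forall>s\<in>torus d. \<forall>t\<in>torus d. \<forall>f\<in>elts R.
        feq (pts R) (tact R (tmult s t) f) (tact R s (tact R t f))) \<and>
     (\<forall>t\<in>torus d.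
        (\<forall>f\<in>elts R. tact R t f \<in> elts R) \<and>
        (\<forall>f\<in>elts R. \<forall>g\<in>elts R. feq (pts R) f g \<longrightarrow> feq (pts R) (tact R t f) (tact R t g)) \<and>
        (\<forall>c. feq (pts R) (tact R t (\<lambda>_. c)) (\<lambda>_. c)) \<and>
        (\<forall>f\<in>elts R. \<forall>g\<in>elts R.
           feq (pts R) (tact R t (\<lambda>x. f x + g x)) (\<lambda>x. tact R t f x + tact R t g x) \<and>
           feq (pts R) (tact R t (\<lambda>x. f x * g x)) (\<lambda>x. tact R t f x * tact R t g x) \<and>
           feq (pts R) (tact R t (brk R f g)) (brk R (tact R t f) (tact R t g))))"

text \<open>Every element lies in the span of a finite family on which the torus acts through a
  matrix of regular functions.\<close>

definition rational_T_action :: "nat \<Rightarrow> 'p tp_alg \<Rightarrow> bool" where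
  "rational_T_action d R \<longleftrightarrow>
     (\<forall>f\<in>elts R. \<exists>m g c. 0 < (m::nat) \<and> g 0 = f \<and> (\<forall>k<m. g k \<in> elts R) \<and>
        (\<forall>k<m. \<forall>l<m. c k l \<in> reg (torus_variety d) (torus d)) \<and>
        (\<forall>k<m. \<forall>t\<in>torus d. feq (pts R) (tact R t (g k)) (\<lambda>x. \<Sum>l<m. c k l t * g l x)))"

definition T_poisson_algebra :: "nat \<Rightarrow> 'p tp_alg \<Rightarrow> bool" where
  "T_poisson_algebra d R \<longleftrightarrow>
     poisson_algebra (pts R) (elts R) (brk R) \<and>
     T_action_by_automorphisms d R \<and> rational_T_action d R"

definition T_poisson_iso ::
  "nat \<Rightarrow> 'p tp_alg \<Rightarrow> 'q tp_alg \<Rightarrow> (('p \<Rightarrow> complex) \<Rightarrow> 'q \<Rightarrow> complex) \<Rightarrow> bool" where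
  "T_poisson_iso d P R I \<longleftrightarrow>
     (\<forall>f\<in>elts P. I f \<in> elts R) \<and>
     (\<forall>f\<in>elts P. \<forall>g\<in>elts P. feq (pts P) f g \<longleftrightarrow> feq (pts R) (I f) (I g)) \<and>
     (\<forall>r\<in>elts R. \<exists>f\<in>elts P. feq (pts R) (I f) r) \<and>
     (\<forall>c. feq (pts R) (I (\<lambda>_. c)) (\<lambda>_. c)) \<and>
     (\<forall>f\<in>elts P. \<forall>g\<in>elts P.
        feq (pts R) (I (\<lambda>x. f x + g x)) (\<lambda>y. I f y + I g y) \<and>
        feq (pts R) (I (\<lambda>x. f x * g x)) (\<lambda>y. I f y * I g y) \<and>
        feq (pts R) (I (brk P f g)) (brk R (I f) (I g))) \<and>
     (\<forall>t\<in>torus d. \<forall>f\<in>elts P. feq (pts R) (I (tact P t f)) (tact R t (I f)))"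

section \<open>Poisson CGL extensions\<close>

type_synonym action_data =
  "(nat \<Rightarrow> (nat \<Rightarrow> complex) \<Rightarrow> complex) \<times> (nat \<Rightarrow> nat \<Rightarrow> complex) \<times> (nat \<Rightarrow> nat \<Rightarrow> complex)"

definition T_action_data :: "nat \<Rightarrow> nat \<Rightarrow> action_data \<Rightarrow> bool" where
  "T_action_data n d = (\<lambda>(\<xi>, h, h').
     \<forall>j<n. torus_character d (\<xi> j) \<and> h j \<in> cspace d \<and> h' j \<in> cspace d \<and>
           char_pairing d (\<xi> j) (h j) \<noteq> 0 \<and> char_pairing d (\<xi> j) (h' j) \<noteq> 0)"

definition symmetric_CGL :: "nat \<Rightarrow> nat \<Rightarrow> (nat \<Rightarrow> complex) tp_alg \<Rightarrow> action_data \<Rightarrow> bool" where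
  "symmetric_CGL n d R = (\<lambda>(\<xi>, h, h').
     pts R = UNIV \<and> elts R = polys {..<n} \<and> T_poisson_algebra d R \<and>
     T_action_data n d (\<xi>, h, h') \<and>
     (\<forall>t\<in>torus d. \<forall>j<n. tact R t (\<lambda>z. z j) = (\<lambda>z. \<xi> j t * z j)) \<and>
     (\<forall>i j. i < j \<and> j < n \<longrightarrow> (\<exists>f\<in>polys {i<..<j}.
        brk R (\<lambda>z. z i) (\<lambda>z. z j) = (\<lambda>z. - char_pairing d (\<xi> i) (h j) * z i * z j - f z) \<and>
        brk R (\<lambda>z. z i) (\<lambda>z. z j) = (\<lambda>z. char_pairing d (\<xi> j) (h' i) * z i * z j - f z))))"

definition homogeneous_poisson_prime ::
  "nat \<Rightarrow> nat \<Rightarrow> (nat \<Rightarrow> complex) tp_alg \<Rightarrow> ((nat \<Rightarrow> complex) \<Rightarrow> complex) \<Rightarrow> bool" where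
  "homogeneous_poisson_prime n d R r \<longleftrightarrow>
     r \<in> polys {..<n} \<and> ring_prime\<^bsub>poly_ring n\<^esub> r \<and>
     (\<exists>\<mu>. torus_character d \<mu> \<and> (\<forall>t\<in>torus d. tact R t r = (\<lambda>z. \<mu> t * r z))) \<and>
     (\<forall>f\<in>polys {..<n}. \<exists>g\<in>polys {..<n}. brk R r f = (\<lambda>z. r z * g z))"

text \<open>The localization of the polynomial ring at \<open>ys\<close>, as functions on a set \<open>Z\<close> of points of
  affine space on which no element of \<open>ys\<close> vanishes.\<close>

definition localization ::
  "nat \<Rightarrow> ((nat \<Rightarrow> complex) \<Rightarrow> complex) list \<Rightarrow> (nat \<Rightarrow> complex) set \<Rightarrow> ((nat \<Rightarrow> complex) \<Rightarrow> complex) set" where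
  "localization n ys Z =
     {f. \<exists>p\<in>polys {..<n}. \<exists>a :: nat \<Rightarrow> nat. feq Z f (\<lambda>z. p z / (\<Prod>i<length ys. (ys ! i) z ^ a i))}"

text \<open>The underlying set \<open>pts R\<close> is a nonempty Zariski open subset of affine space, so that the
  localized polynomial ring is faithfully represented by functions on it.\<close>

definition localized_symmetric_CGL :: "nat \<Rightarrow> nat \<Rightarrow> (nat \<Rightarrow> complex) tp_alg \<Rightarrow> action_data \<Rightarrow> bool" where
  "localized_symmetric_CGL n d R = (\<lambda>(\<xi>, h, h').
     openin (zariski n) (pts R) \<and> pts R \<noteq> {} \<and> T_poisson_algebra d R \<and>
     (\<forall>t\<in>torus d. \<forall>j<n. feq (pts R) (tact R t (\<lambda>z. z j)) (\<lambda>z. \<xi> j t * z j)) \<and>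
     (\<exists>R\<^sub>0 ys. symmetric_CGL n d R\<^sub>0 (\<xi>, h, h') \<and>
        (\<forall>y\<in>set ys. homogeneous_poisson_prime n d R\<^sub>0 y \<and> (\<forall>z\<in>pts R. y z \<noteq> 0)) \<and>
        elts R = localization n ys (pts R) \<and>
        (\<forall>p\<in>polys {..<n}. \<forall>q\<in>polys {..<n}. feq (pts R) (brk R p q) (brk R\<^sub>0 p q))))"

definition CGL_presentation ::
  "nat \<Rightarrow> 'p tp_alg \<Rightarrow> nat \<Rightarrow> nat \<Rightarrow> (nat \<Rightarrow> complex) tp_alg \<Rightarrow> action_data \<Rightarrow>
   ((nat \<Rightarrow> complex) \<Rightarrow> nat \<Rightarrow> complex) \<Rightarrow> (('p \<Rightarrow> complex) \<Rightarrow> (nat \<Rightarrow> complex) \<Rightarrow> complex) \<Rightarrow> bool" where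
  "CGL_presentation d P d' n R D E I \<longleftrightarrow>
     T_poisson_algebra d P \<and> localized_symmetric_CGL n d' R D \<and> torus_embedding d d' E \<and>
     T_poisson_iso d P (R\<lparr>tact := tact R \<circ> E\<rparr>) I"

section \<open>Poisson-Ore varieties\<close>

text \<open>On a smooth variety a Poisson bivector field \<open>\<pi>\<close> is the same as a Poisson bracket on the
  sheaf of regular functions, \<open>br U f g\<close> being the function \<open>\<pi>(df, dg)\<close> on \<open>U\<close>.\<close>

definition poisson_structure ::
  "'a fspace \<Rightarrow> ('a set \<Rightarrow> ('a \<Rightarrow> complex) \<Rightarrow> ('a \<Rightarrow> complex) \<Rightarrow> 'a \<Rightarrow> complex) \<Rightarrow> bool" where
  "poisson_structure X br \<longleftrightarrow>
     (\<forall>U. openin (ztop X) U \<longrightarrow> poisson_algebra U (reg X U) (br U)) \<and>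
     (\<forall>U V. openin (ztop X) U \<and> openin (ztop X) V \<and> V \<subseteq> U \<longrightarrow>
        (\<forall>f\<in>reg X U. \<forall>g\<in>reg X U. feq V (br V f g) (br U f g)))"

definition algebraic_T_action ::
  "nat \<Rightarrow> 'a fspace \<Rightarrow> ((nat \<Rightarrow> complex) \<Rightarrow> 'a \<Rightarrow> 'a) \<Rightarrow> bool" where
  "algebraic_T_action d X act \<longleftrightarrow>
     morphism (prod_fspace (torus_variety d) X) X (\<lambda>(t, x). act t x) \<and>
     (\<forall>x\<in>points X. act (tone d) x = x) \<and>
     (\<forall>s\<in>torus d. \<forall>t\<in>torus d. \<forall>x\<in>points X. act (tmult s t) x = act s (act t x))"

definition T_poisson_variety ::
  "nat \<Rightarrow> nat \<Rightarrow> 'a fspace \<Rightarrow> ('a set \<Rightarrow> ('a \<Rightarrow> complex) \<Rightarrow> ('a \<Rightarrow> complex) \<Rightarrow> 'a \<Rightarrow> complex) \<Rightarrow>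
   ((nat \<Rightarrow> complex) \<Rightarrow> 'a \<Rightarrow> 'a) \<Rightarrow> bool" where
  "T_poisson_variety d n X br act \<longleftrightarrow>
     variety X \<and> irreducible_in (ztop X) (points X) \<and> has_dimension X n \<and> smooth_of_dim X n \<and>
     poisson_structure X br \<and> algebraic_T_action d X act \<and>
     (\<forall>t\<in>torus d. \<forall>U. openin (ztop X) U \<longrightarrow>
        (let V = {x \<in> points X. act t x \<in> U} in
         \<forall>f\<in>reg X U. \<forall>g\<in>reg X U. feq V (br V (f \<circ> act t) (g \<circ> act t)) (br U f g \<circ> act t)))"

definition coordinate_T_poisson_algebra ::
  "'a fspace \<Rightarrow> ('a set \<Rightarrow> ('a \<Rightarrow> complex) \<Rightarrow> ('a \<Rightarrow> complex) \<Rightarrow> 'a \<Rightarrow> complex) \<Rightarrow>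
   ((nat \<Rightarrow> complex) \<Rightarrow> 'a \<Rightarrow> 'a) \<Rightarrow> 'a set \<Rightarrow> 'a tp_alg" where
  "coordinate_T_poisson_algebra X br act U =
     \<lparr>pts = U, elts = reg X U, brk = br U, tact = (\<lambda>t f. f \<circ> act t)\<rparr>"

text \<open>The parameter space \<open>Z\<close> of a chart is required to be affine, as is implicit in
  recovering a chart from its coordinate algebra (and in speaking of Property Q on its image):
  removing a set of codimension two from \<open>Z\<close> would not change the coordinate algebra but can
  destroy completeness of flows.\<close>

definition T_coordinate_chart ::
  "nat \<Rightarrow> nat \<Rightarrow> 'a fspace \<Rightarrow> ((nat \<Rightarrow> complex) \<Rightarrow> 'a \<Rightarrow> 'a) \<Rightarrow>
   (nat \<Rightarrow> complex) set \<Rightarrow> ((nat \<Rightarrow> complex) \<Rightarrow> 'a) \<Rightarrow> bool" where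
  "T_coordinate_chart d n X act Z \<rho> \<longleftrightarrow>
     openin (zariski n) Z \<and> affine_variety (sub_fspace (affine_space n) Z) \<and>
     openin (ztop X) (\<rho> ` Z) \<and> (\<forall>t\<in>torus d. act t ` (\<rho> ` Z) \<subseteq> \<rho> ` Z) \<and>
     isomorphism (sub_fspace (affine_space n) Z) (sub_fspace X (\<rho> ` Z)) \<rho>"

definition presented_in_chart ::
  "nat \<Rightarrow> nat \<Rightarrow> 'a fspace \<Rightarrow> ('a set \<Rightarrow> ('a \<Rightarrow> complex) \<Rightarrow> ('a \<Rightarrow> complex) \<Rightarrow> 'a \<Rightarrow> complex) \<Rightarrow>
   ((nat \<Rightarrow> complex) \<Rightarrow> 'a \<Rightarrow> 'a) \<Rightarrow> (nat \<Rightarrow> complex) set \<Rightarrow> ((nat \<Rightarrow> complex) \<Rightarrow> 'a) \<Rightarrow> bool" where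
  "presented_in_chart d n X br act Z \<rho> \<longleftrightarrow>
     (\<exists>d' E D R. pts R = Z \<and> elts R = reg (affine_space n) Z \<and>
        CGL_presentation d (coordinate_T_poisson_algebra X br act (\<rho> ` Z)) d' n R D E (\<lambda>f. f \<circ> \<rho>))"

type_synonym 'a atlas = "((nat \<Rightarrow> complex) set \<times> ((nat \<Rightarrow> complex) \<Rightarrow> 'a)) set"

definition T_poisson_ore_variety ::
  "nat \<Rightarrow> nat \<Rightarrow> 'a fspace \<Rightarrow> ('a set \<Rightarrow> ('a \<Rightarrow> complex) \<Rightarrow> ('a \<Rightarrow> complex) \<Rightarrow> 'a \<Rightarrow> complex) \<Rightarrow>
   ((nat \<Rightarrow> complex) \<Rightarrow> 'a \<Rightarrow> 'a) \<Rightarrow> 'a atlas \<Rightarrow> bool" where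
  "T_poisson_ore_variety d n X br act \<A> \<longleftrightarrow>
     T_poisson_variety d n X br act \<and> rational_variety X n \<and>
     (\<Union>(Z, \<rho>)\<in>\<A>. \<rho> ` Z) = points X \<and>
     (\<forall>(Z, \<rho>)\<in>\<A>. T_coordinate_chart d n X act Z \<rho> \<and> presented_in_chart d n X br act Z \<rho>)"

definition poisson_ore_variety ::
  "nat \<Rightarrow> 'a fspace \<Rightarrow> ('a set \<Rightarrow> ('a \<Rightarrow> complex) \<Rightarrow> ('a \<Rightarrow> complex) \<Rightarrow> 'a \<Rightarrow> complex) \<Rightarrow> 'a atlas \<Rightarrow> bool" where
  "poisson_ore_variety n X br \<A> \<longleftrightarrow> (\<exists>d act. T_poisson_ore_variety d n X br act \<A>)"

section \<open>Property Q\<close>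

definition quasi_polynomials :: "(complex \<Rightarrow> complex) set" where
  "quasi_polynomials =
     {\<gamma>. \<exists>N q a. inj_on a {..<(N::nat)} \<and> \<gamma> = (\<lambda>c. \<Sum>k<N. poly (q k) c * exp (a k * c))}"

definition property_Q :: "'a fspace \<Rightarrow> (complex \<Rightarrow> 'a) \<Rightarrow> bool" where
  "property_Q Y \<gamma> \<longleftrightarrow>
     (\<exists>m I. closed_embedding Y (affine_space m) I \<and> (\<forall>l<m. (\<lambda>c. I (\<gamma> c) l) \<in> quasi_polynomials))"

text \<open>Integral curves, on an open set \<open>D\<close> of complex times, of a derivation \<open>H\<close> of the regular
  functions on an affine variety \<open>Y\<close>.\<close>

definition integral_curve ::
  "'a fspace \<Rightarrow> (('a \<Rightarrow> complex) \<Rightarrow> 'a \<Rightarrow> complex) \<Rightarrow> complex set \<Rightarrow> (complex \<Rightarrow> 'a) \<Rightarrow> bool" where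
  "integral_curve Y H D \<gamma> \<longleftrightarrow>
     \<gamma> ` D \<subseteq> points Y \<and>
     (\<forall>g\<in>reg Y (points Y). \<forall>c\<in>D. ((\<lambda>s. g (\<gamma> s)) has_field_derivative H g (\<gamma> c)) (at c))"

text \<open>The Hamiltonian vector field of \<open>f\<close> is the derivation \<open>br f\<close>.\<close>

definition complete_hamiltonian_flow_Q ::
  "'a fspace \<Rightarrow> (('a \<Rightarrow> complex) \<Rightarrow> ('a \<Rightarrow> complex) \<Rightarrow> 'a \<Rightarrow> complex) \<Rightarrow> ('a \<Rightarrow> complex) \<Rightarrow> bool" where
  "complete_hamiltonian_flow_Q Y br f \<longleftrightarrow>
     (\<forall>p\<in>points Y. \<exists>\<gamma>. integral_curve Y (br f) UNIV \<gamma> \<and> \<gamma> 0 = p) \<and>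
     (\<forall>D \<gamma>. open D \<and> connected D \<and> D \<noteq> {} \<and> integral_curve Y (br f) D \<gamma> \<longrightarrow>
        (\<exists>\<gamma>'. integral_curve Y (br f) UNIV \<gamma>' \<and> (\<forall>c\<in>D. \<gamma>' c = \<gamma> c) \<and> property_Q Y \<gamma>'))"

definition chart_coordinate ::
  "(nat \<Rightarrow> complex) set \<Rightarrow> ((nat \<Rightarrow> complex) \<Rightarrow> 'a) \<Rightarrow> nat \<Rightarrow> 'a \<Rightarrow> complex" where
  "chart_coordinate Z \<rho> j = (\<lambda>x. inv_into Z \<rho> x j)"

end

theory Submission
  imports Defs "HOL-Complex_Analysis.Conformal_Mappings"
begin

text \<open>
  In a chart the Poisson algebra is a localized symmetric Poisson CGL extension, and the chart
  coordinate is one of its generators \<open>z j\<close>. Before localization the Hamiltonian equations of \<open>z j\<close> on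
  affine space are triangular: \<open>z j\<close> is constant, and
  \<open>z k' = a k * z j * z k + g k\<close>, where the polynomial \<open>g k\<close> involves only variables with index
  strictly between \<open>j\<close> and \<open>k\<close> (\<open>symmetric_CGL_hamiltonian_field\<close>). Moving away from \<open>j\<close> on both sides,
  they are solved successively by scalar linear equations with constant coefficients and
  quasi-polynomial inhomogeneity. These have unique solutions, defined for all times, which are
  again quasi-polynomials (\<open>triangular_ode_solution\<close>, \<open>triangular_ode_unique\<close>).

  For the localization let \<open>y\<close> be one of the inverted Poisson prime elements. Along the flow the function
  \<open>u = y \<circ> x\<close> satisfies \<open>u' = u * v\<close> with quasi-polynomials \<open>u\<close> and \<open>v\<close>. Hence \<open>u\<close> is a constant times
  the exponential of a primitive of \<open>v\<close>, and since \<open>u\<close> has exponential type, the Borel-Caratheodory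
  inequality and Liouville's theorem show that this primitive is affine. So \<open>1 / u\<close> is a multiple of an
  exponential function, in particular a quasi-polynomial (\<open>quasi_polynomials_zero_free\<close>).

  It remains to see that the flow stays in the parameter space \<open>Z\<close> of the chart. As \<open>Z\<close> is
  affine and its regular functions are the elements of the localization, \<open>Z\<close> contains every point
  at which the inverted elements do not vanish (\<open>affine_open_contains_nonvanishing\<close>). All regular
  functions on \<open>Z\<close>, among them the components of a closed embedding, are then quasi-polynomials along
  the flow.
\<close>

section \<open>Quasi-polynomials\<close>

text \<open>Indexing a quasi-polynomial by its finite set of exponents removes the distinctness
  condition.\<close>

lemma quasi_polynomials_iff:
  "\<gamma> \<in> quasi_polynomials \<longleftrightarrow>
     (\<exists>A q. finite A \<and> \<gamma> = (\<lambda>c. \<Sum>a\<in>A. poly (q a) c * exp (a * c)))" (is "?L \<longleftrightarrow> ?R")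
proof
  assume ?L
  then obtain N q a where inj: "inj_on a {..<(N::nat)}"
    and \<gamma>: "\<gamma> = (\<lambda>c. \<Sum>k<N. poly (q k) c * exp (a k * c))"
    unfolding quasi_polynomials_def by blast
  define q' where "q' = q \<circ> the_inv_into {..<N} a"
  have "\<gamma> = (\<lambda>c. \<Sum>b\<in>a ` {..<N}. poly (q' b) c * exp (b * c))"
    unfolding \<gamma> using inj by (auto simp: sum.reindex q'_def the_inv_into_f_f intro!: sum.cong)
  thus ?R by blast
next
  assume ?R
  then obtain A q where A: "finite A" and \<gamma>: "\<gamma> = (\<lambda>c. \<Sum>a\<in>A. poly (q a) c * exp (a * c))"
    by blast
  obtain a where a: "bij_betw a {..<card A} A"
    using ex_bij_betw_nat_finite[OF A] by (auto simp: lessThan_atLeast0)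
  have "\<gamma> = (\<lambda>c. \<Sum>k<card A. poly ((q \<circ> a) k) c * exp (a k * c))"
    unfolding \<gamma> using sum.reindex_bij_betw[OF a, of "\<lambda>b. poly (q b) _ * exp (b * _)"] by simp
  moreover have "inj_on a {..<card A}" using a by (rule bij_betw_imp_inj_on)
  ultimately show ?L unfolding quasi_polynomials_def by blast
qed

lemma quasi_polynomials_term: "(\<lambda>c. poly p c * exp (a * c)) \<in> quasi_polynomials"
  unfolding quasi_polynomials_iff by (intro exI[of _ "{a}"] exI[of _ "\<lambda>_. p"]) simp

lemma quasi_polynomials_add:
  assumes "f \<in> quasi_polynomials" "g \<in> quasi_polynomials"
  shows "(\<lambda>c. f c + g c) \<in> quasi_polynomials"
proof -
  obtain A p where A: "finite A" "f = (\<lambda>c. \<Sum>a\<in>A. poly (p a) c * exp (a * c))"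
    using assms(1) unfolding quasi_polynomials_iff by blast
  obtain B q where B: "finite B" "g = (\<lambda>c. \<Sum>a\<in>B. poly (q a) c * exp (a * c))"
    using assms(2) unfolding quasi_polynomials_iff by blast
  define r where "r a = (if a \<in> A then p a else 0) + (if a \<in> B then q a else 0)" for a
  have "f c = (\<Sum>a\<in>A \<union> B. poly (if a \<in> A then p a else 0) c * exp (a * c))" for c
    unfolding A(2) using A(1) B(1) by (intro sum.mono_neutral_cong_left) auto
  moreover have "g c = (\<Sum>a\<in>A \<union> B. poly (if a \<in> B then q a else 0) c * exp (a * c))" for c
    unfolding B(2) using A(1) B(1) by (intro sum.mono_neutral_cong_left) auto
  ultimately have "(\<lambda>c. f c + g c) = (\<lambda>c. \<Sum>a\<in>A \<union> B. poly (r a) c * exp (a * c))"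
    unfolding r_def poly_add distrib_right sum.distrib by presburger
  thus ?thesis unfolding quasi_polynomials_iff using A(1) B(1) by blast
qed

lemma quasi_polynomials_poly: "poly p \<in> quasi_polynomials"
  using quasi_polynomials_term[of p 0] by simp

lemma quasi_polynomials_const: "(\<lambda>_. b) \<in> quasi_polynomials"
proof -
  have "poly [:b:] = (\<lambda>_. b)" by (simp add: fun_eq_iff)
  thus ?thesis using quasi_polynomials_poly[of "[:b:]"] by simp
qed

lemma quasi_polynomials_exp: "(\<lambda>c. exp (a * c)) \<in> quasi_polynomials"
  using quasi_polynomials_term[of 1 a] by simp

lemma quasi_polynomials_sum:
  assumes "\<And>i. i \<in> S \<Longrightarrow> f i \<in> quasi_polynomials"
  shows "(\<lambda>c. \<Sum>i\<in>S. f i c) \<in> quasi_polynomials"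
  using assms
  by (induction S rule: infinite_finite_induct)
     (auto intro!: quasi_polynomials_add quasi_polynomials_const)

lemma quasi_polynomials_mult:
  assumes "f \<in> quasi_polynomials" "g \<in> quasi_polynomials"
  shows "(\<lambda>c. f c * g c) \<in> quasi_polynomials"
proof -
  obtain A p where A: "finite A" "f = (\<lambda>c. \<Sum>a\<in>A. poly (p a) c * exp (a * c))"
    using assms(1) unfolding quasi_polynomials_iff by blast
  obtain B q where B: "finite B" "g = (\<lambda>c. \<Sum>a\<in>B. poly (q a) c * exp (a * c))"
    using assms(2) unfolding quasi_polynomials_iff by blast
  have "(\<lambda>c. f c * g c) = (\<lambda>c. \<Sum>a\<in>A. \<Sum>b\<in>B. poly (p a * q b) c * exp ((a + b) * c))"
    unfolding A(2) B(2) by (simp add: sum_product distrib_right distrib_left exp_add mult_ac)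
  also have "\<dots> \<in> quasi_polynomials" by (intro quasi_polynomials_sum quasi_polynomials_term)
  finally show ?thesis .
qed

lemma quasi_polynomials_uminus:
  "f \<in> quasi_polynomials \<Longrightarrow> (\<lambda>c. - f c) \<in> quasi_polynomials"
  using quasi_polynomials_mult[OF quasi_polynomials_const[of "-1"]] by simp

lemma quasi_polynomials_power:
  "f \<in> quasi_polynomials \<Longrightarrow> (\<lambda>c. f c ^ k) \<in> quasi_polynomials"
  by (induction k) (auto intro: quasi_polynomials_const quasi_polynomials_mult)

lemma quasi_polynomials_prod:
  assumes "\<And>i. i \<in> S \<Longrightarrow> f i \<in> quasi_polynomials"
  shows "(\<lambda>c. \<Prod>i\<in>S. f i c) \<in> quasi_polynomials"
  using assms
  by (induction S rule: infinite_finite_induct)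
     (auto intro!: quasi_polynomials_mult quasi_polynomials_const)

lemma polys_comp_quasi_polynomials:
  assumes "p \<in> polys I" "\<And>i. i \<in> I \<Longrightarrow> (\<lambda>c. x c i) \<in> quasi_polynomials"
  shows "(\<lambda>c. p (x c)) \<in> quasi_polynomials"
  using assms
  by induction (auto intro: quasi_polynomials_const quasi_polynomials_add quasi_polynomials_mult)

subsection \<open>Primitives\<close>

lemma poly_antiderivative:
  fixes p :: "complex poly"
  shows "\<exists>P. pderiv P = p"
proof -
  have pderiv_sum: "pderiv (sum f A) = (\<Sum>i\<in>A. pderiv (f i))" for f :: "nat \<Rightarrow> complex poly" and A
    using higher_pderiv_sum[of 1 f A] by simp
  define P where "P = (\<Sum>i\<le>degree p. Polynomial.monom (Polynomial.coeff p i / of_nat (Suc i)) (Suc i))"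
  have "pderiv P = (\<Sum>i\<le>degree p. Polynomial.monom (Polynomial.coeff p i) i)"
    unfolding P_def pderiv_sum by (simp add: pderiv_monom del: of_nat_Suc)
  thus ?thesis by (auto simp: poly_as_sum_of_monoms)
qed

lemma poly_exp_antiderivative:
  fixes p :: "complex poly"
  shows "\<exists>P. pderiv P + Polynomial.smult b P = p"
proof (cases "b = 0")
  case True
  thus ?thesis using poly_antiderivative[of p] by simp
next
  case False
  show ?thesis
  proof (induction "degree p" arbitrary: p rule: less_induct)
    case less
    show ?case
    proof (cases "degree p = 0")
      case True
      then obtain a where p: "p = [:a:]" by (rule degree_eq_zeroE)
      thus ?thesis using False by (intro exI[of _ "[:a / b:]"]) (simp add: pderiv_pCons)
    next
      case nz: False
      \<comment> \<open>Integration by parts lowers the degree.\<close>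
      hence "degree (Polynomial.smult (- 1 / b) (pderiv p)) < degree p"
        using False by (simp add: degree_pderiv)
      from less[OF this] obtain P where P: "pderiv P + Polynomial.smult b P = Polynomial.smult (- 1 / b) (pderiv p)"
        by blast
      have "pderiv (P + Polynomial.smult (1 / b) p) + Polynomial.smult b (P + Polynomial.smult (1 / b) p) =
          (pderiv P + Polynomial.smult b P) + Polynomial.smult (1 / b) (pderiv p) + p"
        using False by (simp add: pderiv_add pderiv_smult smult_add_right)
      also have "\<dots> = p" unfolding P by simp
      finally show ?thesis by blast
    qed
  qed
qed

lemma quasi_polynomials_antiderivative:
  assumes "f \<in> quasi_polynomials"
  obtains F where "F \<in> quasi_polynomials" "\<And>c. (F has_field_derivative f c) (at c)"
proof -
  obtain A p where A: "finite A" and f: "f = (\<lambda>c. \<Sum>a\<in>A. poly (p a) c * exp (a * c))"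
    using assms unfolding quasi_polynomials_iff by blast
  have "\<forall>a. \<exists>P. pderiv P + Polynomial.smult a P = p a" using poly_exp_antiderivative by blast
  then obtain P where P: "\<And>a. pderiv (P a) + Polynomial.smult a (P a) = p a" by metis
  define F where "F = (\<lambda>c. \<Sum>a\<in>A. poly (P a) c * exp (a * c))"
  have "(F has_field_derivative f c) (at c)" for c
    unfolding F_def f
    by (auto intro!: derivative_eq_intros sum.cong simp: P[symmetric] algebra_simps)
  moreover have "F \<in> quasi_polynomials" unfolding F_def quasi_polynomials_iff using A by blast
  ultimately show thesis using that by blast
qed

lemma deriv_zero_imp_eq:
  fixes f :: "complex \<Rightarrow> complex"
  assumes "open D" "connected D" "\<And>c. c \<in> D \<Longrightarrow> (f has_field_derivative 0) (at c)" "c \<in> D" "c0 \<in> D"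
  shows "f c = f c0"
proof (rule has_derivative_zero_unique_connected[OF assms(1,2) _ assms(4,5)])
  fix x assume "x \<in> D"
  from assms(3)[OF this] show "(f has_derivative (\<lambda>_. 0)) (at x)"
    by (simp add: has_field_derivative_def lambda_zero)
qed

subsection \<open>Zero-free quasi-polynomials\<close>

lemma poly_growth:
  "\<exists>A C. 0 \<le> A \<and> 0 \<le> C \<and> (\<forall>c::complex. norm (poly p c) \<le> C * exp (A * norm c))"
proof (induction p)
  case 0
  show ?case by (intro exI[of _ 0]) simp
next
  case (pCons b p)
  then obtain A C where AC: "0 \<le> A" "0 \<le> C" "\<And>c::complex. norm (poly p c) \<le> C * exp (A * norm c)"
    by blast
  have "norm (poly (pCons b p) c) \<le> (norm b + C) * exp ((A + 1) * norm c)" for c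
  proof -
    have "norm c \<le> exp (norm c)" using exp_ge_add_one_self[of "norm c"] by linarith
    hence "norm c * norm (poly p c) \<le> exp (norm c) * (C * exp (A * norm c))"
      using AC by (intro mult_mono) auto
    moreover have "norm b * 1 \<le> norm b * exp ((A + 1) * norm c)"
      using AC by (intro mult_left_mono) auto
    moreover have "norm (poly (pCons b p) c) \<le> norm b + norm c * norm (poly p c)"
      by (simp add: norm_triangle_ineq flip: norm_mult)
    ultimately show ?thesis by (simp add: distrib_right distrib_left exp_add mult_ac)
  qed
  thus ?case using AC by (intro exI[of _ "A + 1"] exI[of _ "norm b + C"]) auto
qed

lemma quasi_polynomials_growth:
  assumes "f \<in> quasi_polynomials"
  shows "\<exists>A C. 0 \<le> A \<and> 0 \<le> C \<and> (\<forall>c. norm (f c) \<le> C * exp (A * norm c))"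
proof -
  obtain S p where S: "finite S" and f: "f = (\<lambda>c. \<Sum>a\<in>S. poly (p a) c * exp (a * c))"
    using assms unfolding quasi_polynomials_iff by blast
  show ?thesis unfolding f using S
  proof (induction S)
    case empty
    show ?case by (intro exI[of _ 0]) simp
  next
    case (insert a S)
    then obtain A C where AC: "0 \<le> A" "0 \<le> C"
      "\<And>c. norm (\<Sum>a\<in>S. poly (p a) c * exp (a * c)) \<le> C * exp (A * norm c)" by blast
    obtain A' C' where AC': "0 \<le> A'" "0 \<le> C'" "\<And>c. norm (poly (p a) c) \<le> C' * exp (A' * norm c)"
      using poly_growth[of "p a"] by blast
    let ?B = "A + A' + norm a"
    have "norm (\<Sum>a\<in>insert a S. poly (p a) c * exp (a * c)) \<le> (C + C') * exp (?B * norm c)" for c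
    proof -
      have "norm (exp (a * c)) \<le> exp (norm a * norm c)"
        using complex_Re_le_cmod[of "a * c"] by (simp add: norm_mult)
      hence "norm (poly (p a) c * exp (a * c)) \<le> (C' * exp (A' * norm c)) * exp (norm a * norm c)"
        unfolding norm_mult using AC' by (intro mult_mono) auto
      also have "\<dots> = C' * exp ((A' + norm a) * norm c)" by (simp add: distrib_right exp_add)
      also have "\<dots> \<le> C' * exp (?B * norm c)"
        using AC AC' by (intro mult_left_mono) (auto intro!: mult_right_mono)
      finally have "norm (poly (p a) c * exp (a * c)) \<le> C' * exp (?B * norm c)" .
      moreover have "C * exp (A * norm c) \<le> C * exp (?B * norm c)"
        using AC AC' by (intro mult_left_mono) (auto intro!: mult_right_mono)
      ultimately show ?thesis
        using AC(3)[of c] insert(1,2) norm_triangle_ineq[of "poly (p a) c * exp (a * c)"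
            "\<Sum>a\<in>S. poly (p a) c * exp (a * c)"]
        by (simp add: distrib_right)
    qed
    thus ?case using AC AC' by (intro exI[of _ ?B] exI[of _ "C + C'"]) auto
  qed
qed

text \<open>The Borel-Caratheodory inequality for concentric discs with radii in ratio \<open>2\<close>.\<close>

lemma borel_caratheodory:
  fixes g :: "complex \<Rightarrow> complex"
  assumes hol: "g holomorphic_on ball 0 r" and g0: "g 0 = 0" and r: "0 < r"
    and Re: "\<And>z. norm z < r \<Longrightarrow> Re (g z) < M"
    and z: "norm z \<le> r / 2"
  shows "norm (g z) \<le> 2 * M"
proof -
  have M: "0 < M" using Re[of 0] r g0 by simp
  \<comment> \<open>Schwarz's lemma applies to \<open>g\<close> followed by \<open>u \<mapsto> u / (2 * M - u)\<close>, which maps the half plane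
    \<open>Re u < M\<close> onto the unit disc and fixes \<open>0\<close>.\<close>
  define h where "h w = g (of_real r * w) / (2 * of_real M - g (of_real r * w))" for w
  have sub: "norm (of_real r * w) < r" if "norm w < 1" for w :: complex
    using that r by (simp add: norm_mult)
  have ne: "2 * of_real M - g (of_real r * w) \<noteq> 0" if "norm w < 1" for w
    using Re[OF sub[OF that]] M by (auto simp: complex_eq_iff)
  have "(g \<circ> (*) (of_real r)) holomorphic_on ball 0 1"
    by (rule holomorphic_on_compose_gen[OF _ hol]) (use sub in \<open>auto intro!: holomorphic_intros\<close>)
  hence holh: "h holomorphic_on ball 0 1"
    unfolding h_def comp_def using ne by (intro holomorphic_intros) auto
  have half: "norm u < norm (2 * of_real M - u)" if "Re u < M" for u :: complex
  proof -
    have "(norm (2 * of_real M - u))\<^sup>2 - (norm u)\<^sup>2 = 4 * M * (M - Re u)"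
      unfolding cmod_power2 by (simp add: power2_eq_square algebra_simps)
    also have "\<dots> > 0" using that M by simp
    finally show ?thesis by (simp add: power2_less_imp_less)
  qed
  have "norm (h w) < 1" if "norm w < 1" for w
    using half[OF Re[OF sub[OF that]]] ne[OF that] by (simp add: h_def norm_divide)
  moreover define w where "w = z / of_real r"
  moreover have w: "norm w \<le> 1 / 2" "of_real r * w = z"
    using z r by (simp_all add: w_def norm_divide field_simps)
  ultimately have "norm (h w) \<le> norm w"
    by (intro Schwarz_Lemma(1)[OF holh]) (auto simp: h_def g0)
  hence "norm (h w) \<le> 1 / 2" using w(1) by linarith
  hence "norm (g z) \<le> 1 / 2 * norm (2 * of_real M - g z)"
    using ne[of w] w by (simp add: h_def norm_divide divide_simps)
  also have "\<dots> \<le> 1 / 2 * (2 * M + norm (g z))"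
    using norm_triangle_ineq4[of "2 * of_real M" "g z"] M by (simp add: norm_mult)
  finally show ?thesis by simp
qed

text \<open>An entire function that vanishes at \<open>0\<close> and whose real part grows at most linearly in \<open>\<bar>z\<bar>\<close> is
  linear.\<close>

lemma entire_Re_linear_bound_imp_linear:
  fixes g :: "complex \<Rightarrow> complex"
  assumes hol: "g holomorphic_on UNIV" and g0: "g 0 = 0" and AB: "0 \<le> A" "0 \<le> B"
    and Re: "\<And>z. Re (g z) \<le> A * norm z + B"
  obtains a where "\<And>z. g z = a * z"
proof -
  have "norm (g z) \<le> (4 * A + 2 * B + 2) * norm z ^ 1" if z: "1 \<le> norm z" for z
  proof -
    have "norm (g z) \<le> 2 * (A * (2 * norm z) + B + 1)"
    proof (rule borel_caratheodory[where g = g and r = "2 * norm z" and z = z])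
      show "g holomorphic_on ball 0 (2 * norm z)" using hol holomorphic_on_subset by blast
      show "Re (g w) < A * (2 * norm z) + B + 1" if "norm w < 2 * norm z" for w
        using Re[of w] mult_left_mono[OF less_imp_le[OF that] AB(1)] by linarith
    qed (use z g0 in auto)
    also have "\<dots> \<le> 2 * (A * (2 * norm z) + B * norm z + norm z)"
      using z mult_left_mono[OF z AB(2)] by simp
    finally show ?thesis by (simp add: algebra_simps)
  qed
  hence "g z = (\<Sum>k\<le>1. (deriv ^^ k) g 0 / fact k * z ^ k)" for z
    by (intro Liouville_polynomial[OF hol, of 1]) auto
  thus thesis using that[of "deriv g 0"] g0 by simp
qed

text \<open>The equation \<open>u' = u * v\<close> makes \<open>u\<close> a constant times \<open>exp G\<close> for a primitive \<open>G\<close> of \<open>v\<close>. As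
  a quasi-polynomial \<open>u\<close> is of exponential type, so the real part of \<open>G\<close> grows at most linearly and \<open>G\<close>
  is affine; it is normalised below by \<open>G 0 = 0\<close>.\<close>

lemma quasi_polynomials_zero_free:
  assumes u: "u \<in> quasi_polynomials" and v: "v \<in> quasi_polynomials"
    and ode: "\<And>c. (u has_field_derivative u c * v c) (at c)" and c0: "u c0 \<noteq> 0"
  shows "(\<forall>c. u c \<noteq> 0) \<and> (\<lambda>c. inverse (u c)) \<in> quasi_polynomials"
proof -
  obtain F where F: "\<And>c. (F has_field_derivative v c) (at c)"
    using quasi_polynomials_antiderivative[OF v] by blast
  define G where "G c = F c - F 0" for c
  have G: "(G has_field_derivative v c) (at c)" for c
    unfolding G_def using DERIV_diff[OF F DERIV_const] by simp
  have "((\<lambda>c. u c * exp (- G c)) has_field_derivative 0) (at c)" for c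
    using DERIV_mult[OF ode[of c] DERIV_fun_exp[OF DERIV_minus[OF G[of c]]]]
    by (simp add: algebra_simps)
  hence const: "u c * exp (- G c) = u 0 * exp (- G 0)" for c
    by (intro deriv_zero_imp_eq[of UNIV]) auto
  have uG: "u c = u 0 * exp (G c)" for c
  proof -
    have "u c = (u c * exp (- G c)) * exp (G c)" by (simp add: mult.assoc flip: exp_add)
    also have "\<dots> = u 0 * exp (G c)" using const[of c] by (simp add: G_def)
    finally show ?thesis .
  qed
  have u0: "u 0 \<noteq> 0" using c0 uG[of c0] by auto
  obtain A C where AC: "0 \<le> A" "0 \<le> C" "\<And>c. norm (u c) \<le> C * exp (A * norm c)"
    using quasi_polynomials_growth[OF u] by blast
  define K where "K = C / norm (u 0)"
  have K: "1 \<le> K" using AC(3)[of 0] u0 by (simp add: K_def)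
  have "Re (G c) \<le> A * norm c + ln K" for c
  proof -
    have "norm (u 0) * exp (Re (G c)) \<le> C * exp (A * norm c)"
      using AC(3)[of c] unfolding uG[of c] by (simp add: norm_mult)
    hence "exp (Re (G c)) \<le> K * exp (A * norm c)" using u0 by (simp add: K_def field_simps)
    also have "\<dots> = exp (A * norm c + ln K)" using K by (simp add: exp_add)
    finally show ?thesis by simp
  qed
  moreover have "G holomorphic_on UNIV"
    using G by (meson DERIV_subset field_differentiable_def holomorphic_on_def subset_UNIV)
  ultimately obtain a where a: "\<And>c. G c = a * c"
    using entire_Re_linear_bound_imp_linear[of G A "ln K"] AC(1) K by (auto simp: G_def)
  have inv: "inverse (u c) = inverse (u 0) * exp ((- a) * c)" for c
    by (subst uG) (simp add: a exp_minus)
  have "(\<lambda>c. inverse (u c)) = (\<lambda>c. inverse (u 0) * exp ((- a) * c))"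
    using inv by (rule ext)
  moreover have "\<dots> \<in> quasi_polynomials"
    by (intro quasi_polynomials_mult quasi_polynomials_const quasi_polynomials_exp)
  moreover have "u c \<noteq> 0" for c using u0 by (subst uG) simp
  ultimately show ?thesis by simp
qed

section \<open>Triangular linear systems\<close>

lemma polys_cong: "p \<in> polys I \<Longrightarrow> (\<And>i. i \<in> I \<Longrightarrow> x i = y i) \<Longrightarrow> p x = p y"
  by (induction rule: polys.induct) auto

lemma polys_mono: "p \<in> polys I \<Longrightarrow> I \<subseteq> J \<Longrightarrow> p \<in> polys J"
  by (induction rule: polys.induct) (auto intro: polys.intros)

lemma scalar_linear_ode_solution:
  assumes g: "g \<in> quasi_polynomials"
  obtains x where "x \<in> quasi_polynomials" "x c0 = b"
    "\<And>c. (x has_field_derivative \<alpha> * x c + g c) (at c)"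
proof -
  have "(\<lambda>c. exp ((-\<alpha>) * c) * g c) \<in> quasi_polynomials"
    by (intro quasi_polynomials_mult quasi_polynomials_exp g)
  then obtain F where F: "F \<in> quasi_polynomials"
    "\<And>c. (F has_field_derivative exp ((-\<alpha>) * c) * g c) (at c)"
    by (rule quasi_polynomials_antiderivative) blast
  define x where "x c = exp (\<alpha> * c) * (F c + (exp (- \<alpha> * c0) * b - F c0))" for c
  have "x \<in> quasi_polynomials"
    unfolding x_def
    by (intro quasi_polynomials_mult quasi_polynomials_add quasi_polynomials_exp
        quasi_polynomials_const F(1))
  moreover have "x c0 = b" unfolding x_def by (simp add: exp_minus)
  moreover have "(x has_field_derivative \<alpha> * x c + g c) (at c)" for c
  proof -
    have "(x has_field_derivative
        \<alpha> * x c + exp (\<alpha> * c) * (exp ((-\<alpha>) * c) * g c)) (at c)"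
      unfolding x_def by (rule derivative_eq_intros F(2) refl)+ (simp add: algebra_simps)
    moreover have "exp (\<alpha> * c) * (exp ((-\<alpha>) * c) * g c) = g c"
      unfolding mult.assoc[symmetric] exp_add[symmetric] by simp
    ultimately show ?thesis by (simp only:)
  qed
  ultimately show thesis using that by blast
qed

lemma scalar_linear_ode_unique:
  assumes D: "open D" "connected D" "c0 \<in> D" "c \<in> D" and eq: "x c0 = y c0"
    and x: "\<And>c. c \<in> D \<Longrightarrow> (x has_field_derivative \<alpha> * x c + g c) (at c)"
    and y: "\<And>c. c \<in> D \<Longrightarrow> (y has_field_derivative \<alpha> * y c + g c) (at c)"
  shows "x c = (y c :: complex)"
proof -
  define w where "w c = (x c - y c) * exp (- \<alpha> * c)" for c
  have "(w has_field_derivative 0) (at c)" if "c \<in> D" for c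
    unfolding w_def
    by (rule derivative_eq_intros x[OF that] y[OF that] refl)+ (simp add: algebra_simps)
  hence "w c = w c0" using D by (intro deriv_zero_imp_eq[of D])
  thus ?thesis using eq by (simp add: w_def)
qed

text \<open>A system \<open>x k' = \<alpha> k * x k + g k x\<close> in which \<open>g k\<close> only involves variables of lower rank
  than \<open>k\<close> is solved one rank at a time, by quasi-polynomials.\<close>

lemma triangular_ode_solution:
  fixes rank :: "nat \<Rightarrow> nat"
  assumes g: "\<And>k. k < n \<Longrightarrow> g k \<in> polys {i. i < n \<and> rank i < rank k}"
  obtains x where "\<And>k. k < n \<Longrightarrow> (\<lambda>c. x c k) \<in> quasi_polynomials"
    "\<And>k. x c0 k = b k" "\<And>k c. n \<le> k \<Longrightarrow> x c k = b k"
    "\<And>k c. k < n \<Longrightarrow> ((\<lambda>c. x c k) has_field_derivative \<alpha> k * x c k + g k (x c)) (at c)"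
proof -
  define sol where "sol x k \<longleftrightarrow> (\<lambda>c. x c k) \<in> quasi_polynomials \<and> x c0 k = b k \<and>
    (\<forall>c. ((\<lambda>c. x c k) has_field_derivative \<alpha> k * x c k + g k (x c)) (at c))"
    for x :: "complex \<Rightarrow> nat \<Rightarrow> complex" and k
  have "\<exists>x. \<forall>k<n. rank k < r \<longrightarrow> sol x k" for r
  proof (induction r)
    case 0
    show ?case by simp
  next
    case (Suc r)
    then obtain x where x: "\<And>k. k < n \<Longrightarrow> rank k < r \<Longrightarrow> sol x k" by blast
    have gx: "(\<lambda>c. g k (x c)) \<in> quasi_polynomials" if "k < n" "rank k = r" for k
      by (rule polys_comp_quasi_polynomials[OF g[OF that(1)]])
         (use x that(2) in \<open>auto simp: sol_def\<close>)
    have "\<exists>y. k < n \<and> rank k = r \<longrightarrow> y \<in> quasi_polynomials \<and> y c0 = b k \<and>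
        (\<forall>c. (y has_field_derivative \<alpha> k * y c + g k (x c)) (at c))" for k
      using scalar_linear_ode_solution[OF gx] by metis
    then obtain y where y: "\<And>k. k < n \<Longrightarrow> rank k = r \<Longrightarrow> y k \<in> quasi_polynomials \<and> y k c0 = b k \<and>
        (\<forall>c. (y k has_field_derivative \<alpha> k * y k c + g k (x c)) (at c))" by metis
    define x' where "x' c k = (if rank k = r then y k c else x c k)" for c k
    have "g k (x' c) = g k (x c)" if "k < n" "rank k \<le> r" for k c
      using that(2) by (intro polys_cong[OF g[OF that(1)]]) (auto simp: x'_def)
    hence "\<forall>k<n. rank k < Suc r \<longrightarrow> sol x' k"
      using x y by (auto simp: sol_def x'_def less_Suc_eq)
    thus ?case by blast
  qed
  from this[of "Suc (Max (rank ` {..<n}))"]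
  obtain x where x: "\<And>k. k < n \<Longrightarrow> sol x k" by (auto simp: less_Suc_eq_le)
  define x' where "x' c k = (if k < n then x c k else b k)" for c k
  have "g k (x' c) = g k (x c)" if "k < n" for k c
    by (intro polys_cong[OF g[OF that]]) (auto simp: x'_def)
  hence sol': "sol x' k" if "k < n" for k using x[OF that] that by (simp add: sol_def x'_def)
  show thesis
  proof
    show "x' c0 k = b k" for k using x[of k] by (auto simp: sol_def x'_def)
    show "n \<le> k \<Longrightarrow> x' c k = b k" for k c by (simp add: x'_def)
  qed (use sol' in \<open>simp_all add: sol_def\<close>)
qed

lemma triangular_ode_unique:
  fixes rank :: "nat \<Rightarrow> nat"
  assumes g: "\<And>k. k < n \<Longrightarrow> g k \<in> polys {i. i < n \<and> rank i < rank k}"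
    and D: "open D" "connected D" "c0 \<in> D" and eq: "\<And>k. k < n \<Longrightarrow> x c0 k = y c0 k"
    and x: "\<And>k c. k < n \<Longrightarrow> c \<in> D \<Longrightarrow>
      ((\<lambda>c. x c k) has_field_derivative \<alpha> k * x c k + g k (x c)) (at c)"
    and y: "\<And>k c. k < n \<Longrightarrow> c \<in> D \<Longrightarrow>
      ((\<lambda>c. y c k) has_field_derivative \<alpha> k * y c k + g k (y c)) (at c)"
    and k: "k < n" "c \<in> D"
  shows "x c k = (y c k :: complex)"
  using k
proof (induction "rank k" arbitrary: k c rule: less_induct)
  case less
  have gy: "g k (y c) = g k (x c)" if "c \<in> D" for c
  proof (rule polys_cong[OF g[OF less.prems(1)]])
    show "y c i = x c i" if "i \<in> {i. i < n \<and> rank i < rank k}" for i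
      using less.hyps[of i c] that \<open>c \<in> D\<close> by simp
  qed
  show ?case
  proof (rule scalar_linear_ode_unique[OF D less.prems(2)])
    show "x c0 k = y c0 k" by (rule eq[OF less.prems(1)])
    show "((\<lambda>c. x c k) has_field_derivative \<alpha> k * x c k + g k (x c)) (at c)" if "c \<in> D" for c
      by (rule x[OF less.prems(1) that])
    show "((\<lambda>c. y c k) has_field_derivative \<alpha> k * y c k + g k (x c)) (at c)" if "c \<in> D" for c
      using y[OF less.prems(1) that] unfolding gy[OF that] .
  qed
qed

section \<open>Polynomial functions on affine space\<close>

lemma polys_line:
  assumes "p \<in> polys I"
  shows "\<exists>P. \<forall>t. p (\<lambda>i. a i + t * b i) = poly P t"
  using assms
proof induction
  case (const c)
  show ?case by (intro exI[of _ "[:c:]"]) simp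
next
  case (var i)
  show ?case by (intro exI[of _ "[:a i, b i:]"]) simp
next
  case (add p q)
  thus ?case by (metis poly_add)
next
  case (mult p q)
  thus ?case by (metis poly_mult)
qed

lemma zariski_open_dense:
  assumes Z: "openin (zariski n) Z" "Z \<noteq> {}" and p: "p \<in> polys {..<n}"
    and p0: "\<And>z. z \<in> Z \<Longrightarrow> p z = 0" and w: "w \<in> cspace n"
  shows "p w = 0"
proof -
  obtain S where S: "S \<subseteq> polys {..<n}" "Z = {x \<in> cspace n. \<exists>p\<in>S. p x \<noteq> 0}"
    using Z(1) unfolding openin_zariski zariski_open_def by blast
  then obtain z s where z: "z \<in> cspace n" "s \<in> S" "s z \<noteq> 0" using Z(2) by blast
  hence s: "s \<in> polys {..<n}" using S(1) by blast
  \<comment> \<open>On the line from \<open>z\<close> to \<open>w\<close> the product \<open>p * s\<close> vanishes and \<open>s\<close> does not vanish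
    identically.\<close>
  obtain P where P: "\<And>t. p (\<lambda>i. z i + t * (w i - z i)) = poly P t"
    using polys_line[OF p, of z "\<lambda>i. w i - z i"] by auto
  obtain T where T: "\<And>t. s (\<lambda>i. z i + t * (w i - z i)) = poly T t"
    using polys_line[OF s, of z "\<lambda>i. w i - z i"] by auto
  have "poly (P * T) t = 0" for t
  proof (cases "poly T t = 0")
    case False
    hence "s (\<lambda>i. z i + t * (w i - z i)) \<noteq> 0" unfolding T .
    moreover have "(\<lambda>i. z i + t * (w i - z i)) \<in> cspace n" using z(1) w by (auto simp: cspace_def)
    ultimately have "(\<lambda>i. z i + t * (w i - z i)) \<in> Z"
      unfolding S(2) using z(2) by (intro CollectI conjI bexI[of _ s])
    hence "poly P t = 0" unfolding P[symmetric] by (rule p0)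
    thus ?thesis by simp
  qed simp
  hence "P * T = 0" using poly_all_0_iff_0 by blast
  moreover have "T \<noteq> 0" using T[of 0] z(3) by auto
  ultimately have "P = 0" by simp
  thus ?thesis using P[of 1] by simp
qed

lemma polys_prod:
  "(\<And>i. i \<in> S \<Longrightarrow> f i \<in> polys I) \<Longrightarrow> (\<lambda>x. \<Prod>i\<in>S. f i x) \<in> polys I"
  by (induction S rule: infinite_finite_induct) (auto intro: polys.intros)

lemma polys_power: "f \<in> polys I \<Longrightarrow> (\<lambda>x. f x ^ k) \<in> polys I"
  by (induction k) (auto intro: polys.intros)

section \<open>Affine open subsets of affine space\<close>

lemma points_sub_fspace: "points (sub_fspace X S) = points X \<inter> S"
  by (simp add: sub_fspace_def)

lemma reg_sub_fspace_open:
  assumes restr: "\<And>U V. openin (ztop X) U \<Longrightarrow> openin (ztop X) V \<Longrightarrow> V \<subseteq> U \<Longrightarrow> reg X U \<subseteq> reg X V"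
    and glue: "\<And>U f. openin (ztop X) U \<Longrightarrow>
      (\<And>x. x \<in> U \<Longrightarrow> \<exists>V. openin (ztop X) V \<and> x \<in> V \<and> V \<subseteq> U \<and> (\<exists>g\<in>reg X V. feq V f g)) \<Longrightarrow>
      f \<in> reg X U"
    and U: "openin (ztop X) U"
  shows "reg (sub_fspace X U) U = reg X U"
proof (intro equalityI subsetI)
  fix f assume f: "f \<in> reg (sub_fspace X U) U"
  show "f \<in> reg X U"
  proof (rule glue[OF U])
    fix x assume x: "x \<in> U"
    then obtain V g where V: "openin (ztop X) V" "x \<in> V" "g \<in> reg X V" "feq (V \<inter> U) f g"
      using f by (auto simp: sub_fspace_def)
    have "openin (ztop X) (V \<inter> U)" using V(1) U by (rule openin_Int)
    moreover from this have "g \<in> reg X (V \<inter> U)" using restr[OF V(1)] V(3) by blast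
    ultimately show "\<exists>V. openin (ztop X) V \<and> x \<in> V \<and> V \<subseteq> U \<and> (\<exists>g\<in>reg X V. feq V f g)"
      using x V(2,4) by blast
  qed
next
  fix f assume f: "f \<in> reg X U"
  show "f \<in> reg (sub_fspace X U) U"
    using f U by (auto simp: sub_fspace_def feq_def)
qed

lemma space_with_functions_reg_sub:
  assumes X: "space_with_functions X" and U: "openin (ztop X) U"
  shows "reg (sub_fspace X U) U = reg X U"
proof (rule reg_sub_fspace_open[OF _ _ U])
  have "\<forall>U V. openin (ztop X) U \<and> openin (ztop X) V \<and> V \<subseteq> U \<longrightarrow> reg X U \<subseteq> reg X V"
    using X unfolding space_with_functions_def by (elim conjE)
  thus "reg X V \<subseteq> reg X W" if "openin (ztop X) V" "openin (ztop X) W" "W \<subseteq> V" for V W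
    using that by simp
  have "\<forall>U f. openin (ztop X) U \<and>
      (\<forall>x\<in>U. \<exists>V. openin (ztop X) V \<and> x \<in> V \<and> V \<subseteq> U \<and> (\<exists>g\<in>reg X V. feq V f g)) \<longrightarrow> f \<in> reg X U"
    using X unfolding space_with_functions_def by (elim conjE)
  from this[rule_format] show "f \<in> reg X V" if "openin (ztop X) V"
    "\<And>x. x \<in> V \<Longrightarrow> \<exists>W. openin (ztop X) W \<and> x \<in> W \<and> W \<subseteq> V \<and> (\<exists>g\<in>reg X W. feq W f g)" for V f
    using that by simp
qed

lemma reg_sub_fspaceI:
  "openin (ztop X) U \<Longrightarrow> f \<in> reg X U \<Longrightarrow> V \<subseteq> U \<Longrightarrow> f \<in> reg (sub_fspace X S) V"
  unfolding sub_fspace_def feq_def by auto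

lemma ztop_affine_space: "ztop (affine_space n) = zariski n"
  by (simp add: affine_space_def)

lemma reg_affine_space_iff:
  "f \<in> reg (affine_space n) U \<longleftrightarrow>
     (\<forall>x\<in>U. \<exists>V p q. openin (zariski n) V \<and> x \<in> V \<and> V \<subseteq> U \<and>
        p \<in> polys {..<n} \<and> q \<in> polys {..<n} \<and> (\<forall>y\<in>V. q y \<noteq> 0 \<and> f y = p y / q y))"
  by (simp add: affine_space_def)

lemma reg_sub_affine_space:
  assumes "openin (zariski n) Z"
  shows "reg (sub_fspace (affine_space n) Z) Z = reg (affine_space n) Z"
proof (rule reg_sub_fspace_open)
  fix U V assume UV: "openin (ztop (affine_space n)) V" "V \<subseteq> U"
  show "reg (affine_space n) U \<subseteq> reg (affine_space n) V"
  proof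
    fix f assume f: "f \<in> reg (affine_space n) U"
    show "f \<in> reg (affine_space n) V"
      unfolding reg_affine_space_iff
    proof
      fix x assume x: "x \<in> V"
      then obtain V' p q where V': "openin (zariski n) V'" "x \<in> V'" "p \<in> polys {..<n}" "q \<in> polys {..<n}"
        "\<forall>y\<in>V'. q y \<noteq> 0 \<and> f y = p y / q y"
        using f UV(2) unfolding reg_affine_space_iff by (meson subsetD)
      have "openin (zariski n) (V' \<inter> V)"
        using V'(1) UV(1) by (simp add: ztop_affine_space openin_Int)
      thus "\<exists>V' p q. openin (zariski n) V' \<and> x \<in> V' \<and> V' \<subseteq> V \<and>
          p \<in> polys {..<n} \<and> q \<in> polys {..<n} \<and> (\<forall>y\<in>V'. q y \<noteq> 0 \<and> f y = p y / q y)"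
        using V' x by (intro exI[of _ "V' \<inter> V"] exI[of _ p] exI[of _ q]) simp
    qed
  qed
next
  fix U f
  assume loc: "\<And>x. x \<in> U \<Longrightarrow> \<exists>V. openin (ztop (affine_space n)) V \<and> x \<in> V \<and> V \<subseteq> U \<and>
      (\<exists>g\<in>reg (affine_space n) V. feq V f g)"
  show "f \<in> reg (affine_space n) U"
    unfolding reg_affine_space_iff
  proof
    fix x assume "x \<in> U"
    from loc[OF this] obtain V g where V: "x \<in> V" "V \<subseteq> U" "g \<in> reg (affine_space n) V" "feq V f g"
      by blast
    then obtain V' p q where V': "openin (zariski n) V'" "x \<in> V'" "V' \<subseteq> V" "p \<in> polys {..<n}"
      "q \<in> polys {..<n}" "\<forall>y\<in>V'. q y \<noteq> 0 \<and> g y = p y / q y"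
      unfolding reg_affine_space_iff by meson
    moreover have "\<forall>y\<in>V'. q y \<noteq> 0 \<and> f y = p y / q y"
    proof
      fix y assume "y \<in> V'"
      thus "q y \<noteq> 0 \<and> f y = p y / q y" using V(4) V'(3,6) unfolding feq_def by auto
    qed
    moreover have "V' \<subseteq> U" using V(2) V'(3) by (rule subset_trans[rotated])
    ultimately show "\<exists>V p q. openin (zariski n) V \<and> x \<in> V \<and> V \<subseteq> U \<and>
        p \<in> polys {..<n} \<and> q \<in> polys {..<n} \<and> (\<forall>y\<in>V. q y \<noteq> 0 \<and> f y = p y / q y)"
      by (intro exI[of _ V'] exI[of _ p] exI[of _ q]) simp
  qed
qed (use assms in \<open>simp add: ztop_affine_space\<close>)

lemma polys_in_reg_affine_space:
  assumes "openin (zariski n) U" "p \<in> polys {..<n}"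
  shows "p \<in> reg (affine_space n) U"
  unfolding reg_affine_space_iff
proof
  fix x assume "x \<in> U"
  thus "\<exists>V p' q. openin (zariski n) V \<and> x \<in> V \<and> V \<subseteq> U \<and>
      p' \<in> polys {..<n} \<and> q \<in> polys {..<n} \<and> (\<forall>y\<in>V. q y \<noteq> 0 \<and> p y = p' y / q y)"
    using assms polys.const[of 1 "{..<n}"]
    by (intro exI[of _ U] exI[of _ p] exI[of _ "\<lambda>_. 1"]) simp
qed

lemma morphism_compose:
  assumes "morphism X Y f" "morphism Y W g"
  shows "morphism X W (g \<circ> f)"
  unfolding morphism_def
proof (intro conjI allI impI)
  show "continuous_map (ztop X) (ztop W) (g \<circ> f)"
    using assms unfolding morphism_def by (blast intro: continuous_map_compose)
next
  fix V h assume V: "openin (ztop W) V \<and> h \<in> reg W V"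
  let ?V = "{y \<in> points Y. g y \<in> V}"
  have "openin (ztop Y) ?V" "h \<circ> g \<in> reg Y ?V"
    using assms(2) V by (auto simp: morphism_def continuous_map_def)
  hence "(h \<circ> g) \<circ> f \<in> reg X {x \<in> points X. f x \<in> ?V}"
    using assms(1) unfolding morphism_def by blast
  moreover have "{x \<in> points X. f x \<in> ?V} = {x \<in> points X. (g \<circ> f) x \<in> V}"
    using assms(1) by (auto simp: morphism_def continuous_map_def)
  ultimately show "h \<circ> (g \<circ> f) \<in> reg X {x \<in> points X. (g \<circ> f) x \<in> V}"
    by (simp add: comp_assoc)
qed

lemma morphism_points: "morphism X Y f \<Longrightarrow> x \<in> points X \<Longrightarrow> f x \<in> points Y"
  unfolding morphism_def continuous_map_def by blast

lemma isomorphism_compose: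
  assumes "isomorphism X Y f" "isomorphism Y W g"
  shows "isomorphism X W (g \<circ> f)"
proof -
  obtain f' where f: "morphism X Y f" "morphism Y X f'" "\<forall>x\<in>points X. f' (f x) = x"
    "\<forall>y\<in>points Y. f (f' y) = y" using assms(1) unfolding isomorphism_def by blast
  obtain g' where g: "morphism Y W g" "morphism W Y g'" "\<forall>x\<in>points Y. g' (g x) = x"
    "\<forall>y\<in>points W. g (g' y) = y" using assms(2) unfolding isomorphism_def by blast
  have "\<forall>x\<in>points X. (f' \<circ> g') ((g \<circ> f) x) = x" "\<forall>y\<in>points W. (g \<circ> f) ((f' \<circ> g') y) = y"
    using f g morphism_points[OF f(1)] morphism_points[OF g(2)] by auto
  thus ?thesis
    unfolding isomorphism_def using morphism_compose[OF f(1) g(1)] morphism_compose[OF g(2) f(2)]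
    by blast
qed

lemma isomorphism_inverse:
  assumes "isomorphism X Y f"
  shows "\<exists>g. isomorphism Y X g \<and> (\<forall>x\<in>points X. g (f x) = x) \<and> (\<forall>y\<in>points Y. f (g y) = y)"
  using assms unfolding isomorphism_def by blast

lemma points_sub_affine_space:
  assumes "openin (zariski n) Z"
  shows "points (sub_fspace (affine_space n) Z) = Z"
  using openin_subset[OF assms] by (auto simp: points_sub_fspace ztop_affine_space)

lemma closed_embedding_coordinate_regular:
  assumes Z: "openin (zariski n) Z"
    and emb: "closed_embedding (sub_fspace (affine_space n) Z) (affine_space m) \<phi>" and l: "l < m"
  shows "(\<lambda>z. \<phi> z l) \<in> reg (affine_space n) Z"
proof -
  note ptsZ = points_sub_affine_space[OF Z]
  have cl: "closedin (zariski m) (\<phi> ` Z)"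
    and mor: "morphism (sub_fspace (affine_space n) Z) (sub_fspace (affine_space m) (\<phi> ` Z)) \<phi>"
    using emb unfolding closed_embedding_def isomorphism_def ptsZ ztop_affine_space by blast+
  have Ym: "\<phi> ` Z \<subseteq> cspace m" using closedin_subset[OF cl] by (simp add: topspace_zariski)
  have ptsY: "points (sub_fspace (affine_space m) (\<phi> ` Z)) = \<phi> ` Z"
    using Ym by (auto simp: points_sub_fspace ztop_affine_space topspace_zariski)
  have "(\<lambda>x. x l) \<in> reg (affine_space m) (cspace m)"
    using l openin_topspace[of "zariski m"]
    by (intro polys_in_reg_affine_space polys.var) (simp_all add: topspace_zariski)
  hence "(\<lambda>x. x l) \<in> reg (sub_fspace (affine_space m) (\<phi> ` Z)) (\<phi> ` Z)"
    using Ym openin_topspace[of "zariski m"]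
    by (intro reg_sub_fspaceI) (simp_all add: topspace_zariski ztop_affine_space)
  moreover have "openin (ztop (sub_fspace (affine_space m) (\<phi> ` Z))) (\<phi> ` Z)"
    using ptsY by (metis openin_topspace)
  ultimately have "(\<lambda>x. x l) \<circ> \<phi> \<in> reg (sub_fspace (affine_space n) Z) {z \<in> Z. \<phi> z \<in> \<phi> ` Z}"
    using mor unfolding morphism_def ptsZ by blast
  moreover have "{z \<in> Z. \<phi> z \<in> \<phi> ` Z} = Z" by blast
  ultimately show ?thesis using reg_sub_affine_space[OF Z] by (simp add: comp_def)
qed

subsection \<open>Evaluating fractions outside their domain of definition\<close>

text \<open>The function \<open>g\<close> on \<open>Z\<close> is a fraction whose denominator vanishes neither on \<open>Z\<close> nor at the
  point \<open>w\<close>, which need not lie in \<open>Z\<close>, and \<open>c\<close> is the value of this fraction at \<open>w\<close>.\<close>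

definition fraction_value ::
  "nat \<Rightarrow> (nat \<Rightarrow> complex) set \<Rightarrow> (nat \<Rightarrow> complex) \<Rightarrow> ((nat \<Rightarrow> complex) \<Rightarrow> complex) \<Rightarrow> complex \<Rightarrow> bool" where
  "fraction_value n Z w g c \<longleftrightarrow>
     (\<exists>p\<in>polys {..<n}. \<exists>q\<in>polys {..<n}. q w \<noteq> 0 \<and> (\<forall>z\<in>Z. q z \<noteq> 0 \<and> g z = p z / q z) \<and> c = p w / q w)"

lemma fraction_value_poly: "p \<in> polys {..<n} \<Longrightarrow> fraction_value n Z w p (p w)"
  unfolding fraction_value_def
  by (intro bexI[of _ p] bexI[of _ "\<lambda>_. 1"]) (auto intro: polys.const)

lemma fraction_value_add:
  assumes "fraction_value n Z w g c" "fraction_value n Z w g' c'"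
  shows "fraction_value n Z w (\<lambda>z. g z + g' z) (c + c')"
proof -
  obtain p q where pq: "p \<in> polys {..<n}" "q \<in> polys {..<n}" "q w \<noteq> 0"
    "\<forall>z\<in>Z. q z \<noteq> 0 \<and> g z = p z / q z" "c = p w / q w"
    using assms(1) unfolding fraction_value_def by blast
  obtain p' q' where pq': "p' \<in> polys {..<n}" "q' \<in> polys {..<n}" "q' w \<noteq> 0"
    "\<forall>z\<in>Z. q' z \<noteq> 0 \<and> g' z = p' z / q' z" "c' = p' w / q' w"
    using assms(2) unfolding fraction_value_def by blast
  show ?thesis
    unfolding fraction_value_def
    by (intro bexI[of _ "\<lambda>z. p z * q' z + p' z * q z"] bexI[of _ "\<lambda>z. q z * q' z"])
       (use pq pq' in \<open>auto simp: add_frac_eq intro: polys.intros\<close>)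
qed

lemma fraction_value_mult:
  assumes "fraction_value n Z w g c" "fraction_value n Z w g' c'"
  shows "fraction_value n Z w (\<lambda>z. g z * g' z) (c * c')"
proof -
  obtain p q where pq: "p \<in> polys {..<n}" "q \<in> polys {..<n}" "q w \<noteq> 0"
    "\<forall>z\<in>Z. q z \<noteq> 0 \<and> g z = p z / q z" "c = p w / q w"
    using assms(1) unfolding fraction_value_def by blast
  obtain p' q' where pq': "p' \<in> polys {..<n}" "q' \<in> polys {..<n}" "q' w \<noteq> 0"
    "\<forall>z\<in>Z. q' z \<noteq> 0 \<and> g' z = p' z / q' z" "c' = p' w / q' w"
    using assms(2) unfolding fraction_value_def by blast
  show ?thesis
    unfolding fraction_value_def
    by (intro bexI[of _ "\<lambda>z. p z * p' z"] bexI[of _ "\<lambda>z. q z * q' z"])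
       (use pq pq' in \<open>auto intro: polys.intros\<close>)
qed

lemma fraction_value_compose:
  assumes "s \<in> polys {..<m}" "\<And>l. l < m \<Longrightarrow> fraction_value n Z w (\<lambda>z. \<phi> z l) (v l)"
  shows "fraction_value n Z w (\<lambda>z. s (\<phi> z)) (s v)"
  using assms
proof induction
  case (const c)
  show ?case by (rule fraction_value_poly) (rule polys.const)
qed (auto intro: fraction_value_add fraction_value_mult)

lemma fraction_value_zero:
  assumes Z: "openin (zariski n) Z" "Z \<noteq> {}" and w: "w \<in> cspace n"
    and g: "fraction_value n Z w g c" "\<And>z. z \<in> Z \<Longrightarrow> g z = 0"
  shows "c = 0"
proof -
  obtain p q where pq: "p \<in> polys {..<n}" "\<forall>z\<in>Z. q z \<noteq> 0 \<and> g z = p z / q z" "c = p w / q w"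
    using g(1) unfolding fraction_value_def by blast
  have "p w = 0"
    by (rule zariski_open_dense[OF Z pq(1) _ w]) (use pq(2) g(2) in auto)
  thus ?thesis using pq(3) by simp
qed

lemma localization_fraction_value:
  assumes g: "g \<in> localization n ys Z" and ys: "\<And>y. y \<in> set ys \<Longrightarrow> y \<in> polys {..<n} \<and> y w \<noteq> 0"
    and ysZ: "\<And>y z. y \<in> set ys \<Longrightarrow> z \<in> Z \<Longrightarrow> y z \<noteq> 0"
  shows "\<exists>c. fraction_value n Z w g c"
proof -
  obtain p a where p: "p \<in> polys {..<n}" "feq Z g (\<lambda>z. p z / (\<Prod>i<length ys. (ys ! i) z ^ a i))"
    using g unfolding localization_def by blast
  let ?q = "\<lambda>z. \<Prod>i<length ys. (ys ! i) z ^ a i"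
  have "?q \<in> polys {..<n}" using ys by (intro polys_prod polys_power) auto
  moreover have "?q w \<noteq> 0" using ys by auto
  moreover have "\<forall>z\<in>Z. ?q z \<noteq> 0 \<and> g z = p z / ?q z" using ysZ p(2) by (auto simp: feq_def)
  ultimately have "fraction_value n Z w g (p w / ?q w)"
    unfolding fraction_value_def using p(1) by (intro bexI[of _ p] bexI[of _ ?q]) simp_all
  thus ?thesis ..
qed

text \<open>An affine open subset \<open>Z\<close> of affine space all of whose regular functions are fractions with
  denominators in \<open>ys\<close> contains every point at which the \<open>ys\<close> do not vanish. Indeed evaluation at such
  a point \<open>w\<close> is a character of the coordinate algebra of \<open>Z\<close>, and it is given by a point \<open>z1\<close> of \<open>Z\<close>
  since the image of \<open>Z\<close> under a closed embedding is closed. Then \<open>w\<close> and \<open>z1\<close> have the same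
  coordinates.\<close>

lemma affine_open_contains_nonvanishing:
  assumes Z: "openin (zariski n) Z" "Z \<noteq> {}"
    and aff: "affine_variety (sub_fspace (affine_space n) Z)"
    and reg: "reg (affine_space n) Z \<subseteq> localization n ys Z"
    and ys: "\<And>y. y \<in> set ys \<Longrightarrow> y \<in> polys {..<n} \<and> y w \<noteq> 0"
    and ysZ: "\<And>y z. y \<in> set ys \<Longrightarrow> z \<in> Z \<Longrightarrow> y z \<noteq> 0"
    and w: "w \<in> cspace n"
  shows "w \<in> Z"
proof -
  note ptsZ = points_sub_affine_space[OF Z(1)]
  have Zn: "Z \<subseteq> cspace n" using openin_subset[OF Z(1)] by (simp add: topspace_zariski)
  obtain m \<phi> where emb: "closed_embedding (sub_fspace (affine_space n) Z) (affine_space m) \<phi>"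
    using aff unfolding affine_variety_def by blast
  from this have cl: "closedin (zariski m) (\<phi> ` Z)"
    and iso: "isomorphism (sub_fspace (affine_space n) Z) (sub_fspace (affine_space m) (\<phi> ` Z)) \<phi>"
    unfolding closed_embedding_def ptsZ by (simp_all add: affine_space_def)
  have Ym: "\<phi> ` Z \<subseteq> cspace m" using closedin_subset[OF cl] by (simp add: topspace_zariski)
  have ptsY: "points (sub_fspace (affine_space m) (\<phi> ` Z)) = \<phi> ` Z"
    using Ym by (auto simp: points_sub_fspace affine_space_def topspace_zariski)
  obtain \<psi> where "isomorphism (sub_fspace (affine_space m) (\<phi> ` Z)) (sub_fspace (affine_space n) Z) \<psi>"
    and \<psi>: "\<And>z. z \<in> Z \<Longrightarrow> \<psi> (\<phi> z) = z"
    using isomorphism_inverse[OF iso] unfolding ptsZ by blast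
  hence mor': "morphism (sub_fspace (affine_space m) (\<phi> ` Z)) (sub_fspace (affine_space n) Z) \<psi>"
    unfolding isomorphism_def by blast
  have "\<exists>c. fraction_value n Z w (\<lambda>z. \<phi> z l) c" if "l < m" for l
  proof -
    have "(\<lambda>z. \<phi> z l) \<in> localization n ys Z"
      using closed_embedding_coordinate_regular[OF Z(1) emb that] reg by blast
    thus ?thesis by (rule localization_fraction_value) (use ys ysZ in blast)+
  qed
  then obtain v0 where v0: "\<And>l. l < m \<Longrightarrow> fraction_value n Z w (\<lambda>z. \<phi> z l) (v0 l)" by metis
  define v where "v l = (if l < m then v0 l else 0)" for l
  have vm: "v \<in> cspace m" by (simp add: v_def cspace_def)
  have v: "fraction_value n Z w (\<lambda>z. s (\<phi> z)) (s v)" if "s \<in> polys {..<m}" for s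
    by (rule fraction_value_compose[OF that]) (simp add: v_def v0)
  have "v \<in> \<phi> ` Z"
  proof (rule ccontr)
    assume "v \<notin> \<phi> ` Z"
    moreover have "zariski_open m (cspace m - \<phi> ` Z)"
      using cl by (simp add: closedin_def topspace_zariski flip: openin_zariski)
    then obtain S where S: "S \<subseteq> polys {..<m}" "cspace m - \<phi> ` Z = {x \<in> cspace m. \<exists>p\<in>S. p x \<noteq> 0}"
      unfolding zariski_open_def by blast
    ultimately obtain s where s: "s \<in> S" "s v \<noteq> 0" using vm by blast
    have "s (\<phi> z) = 0" if "z \<in> Z" for z
    proof (rule ccontr)
      assume "s (\<phi> z) \<noteq> 0"
      hence "\<phi> z \<in> cspace m - \<phi> ` Z" unfolding S(2) using that Ym s(1) by auto
      thus False using that by simp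
    qed
    moreover have "fraction_value n Z w (\<lambda>z. s (\<phi> z)) (s v)"
      using s(1) S(1) by (intro v) blast
    ultimately have "s v = 0" using fraction_value_zero[OF Z w, of "\<lambda>z. s (\<phi> z)" "s v"] by simp
    thus False using s(2) by simp
  qed
  then obtain z1 where z1: "z1 \<in> Z" "v = \<phi> z1" by blast
  have "w i = z1 i" if i: "i < n" for i
  proof -
    have "(\<lambda>z. z i) \<in> reg (sub_fspace (affine_space n) Z) Z"
      unfolding reg_sub_affine_space[OF Z(1)]
      using i by (intro polys_in_reg_affine_space[OF Z(1)] polys.var) auto
    moreover have "openin (ztop (sub_fspace (affine_space n) Z)) Z"
      using ptsZ by (metis openin_topspace)
    ultimately have "(\<lambda>z. z i) \<circ> \<psi> \<in> reg (sub_fspace (affine_space m) (\<phi> ` Z)) {y \<in> \<phi> ` Z. \<psi> y \<in> Z}"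
      using mor' unfolding morphism_def ptsY by blast
    moreover have "{y \<in> \<phi> ` Z. \<psi> y \<in> Z} = \<phi> ` Z" using \<psi> by auto
    ultimately have "(\<lambda>z. z i) \<circ> \<psi> \<in> reg (sub_fspace (affine_space m) (\<phi> ` Z)) (\<phi> ` Z)" by simp
    then obtain U g where U: "v \<in> U" "g \<in> reg (affine_space m) U"
      "feq (U \<inter> \<phi> ` Z) ((\<lambda>z. z i) \<circ> \<psi>) g"
      using \<open>v \<in> \<phi> ` Z\<close> unfolding sub_fspace_def by auto
    obtain V p q where V: "openin (zariski m) V" "v \<in> V" "V \<subseteq> U"
      and pq: "p \<in> polys {..<m}" "q \<in> polys {..<m}" "\<forall>y\<in>V. q y \<noteq> 0 \<and> g y = p y / q y"
      using U(1,2) unfolding reg_affine_space_iff by meson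
    obtain S where S: "S \<subseteq> polys {..<m}" "V = {x \<in> cspace m. \<exists>p\<in>S. p x \<noteq> 0}"
      using V(1) unfolding openin_zariski zariski_open_def by blast
    then obtain s where s: "s \<in> S" "s v \<noteq> 0" using V(2) by blast
    \<comment> \<open>Near \<open>v\<close> the \<open>i\<close>-th coordinate is \<open>p / q\<close> in terms of \<open>\<phi>\<close>. Multiplied by \<open>s\<close>, which vanishes on
      \<open>\<phi> ` Z\<close> outside the neighbourhood, this is an identity on all of \<open>Z\<close> and can be evaluated at \<open>w\<close>.\<close>
    have eq: "z i * q (\<phi> z) = p (\<phi> z)" if "z \<in> Z" "s (\<phi> z) \<noteq> 0" for z
    proof -
      have "\<phi> z \<in> V" unfolding S(2) using that s(1) Ym by auto
      moreover from this have "((\<lambda>z. z i) \<circ> \<psi>) (\<phi> z) = g (\<phi> z)"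
        using U(3) V(3) that(1) unfolding feq_def by blast
      ultimately show ?thesis using pq(3) \<psi>[OF that(1)] by simp
    qed
    have "fraction_value n Z w (\<lambda>z. s (\<phi> z) * (z i * q (\<phi> z) + (- 1) * p (\<phi> z)))
        (s v * (w i * q v + (- 1) * p v))"
      using s(1) S(1) i pq
      by (intro fraction_value_mult fraction_value_add v fraction_value_poly) (auto intro: polys.intros)
    moreover have "s (\<phi> z) * (z i * q (\<phi> z) + (- 1) * p (\<phi> z)) = 0" if "z \<in> Z" for z
      using eq[OF that] by auto
    ultimately have "s v * (w i * q v + (- 1) * p v) = 0"
      using fraction_value_zero[OF Z w] by meson
    hence "w i * q v = p v" using s(2) by simp
    also have "\<dots> = z1 i * q v" using eq[of z1] z1 s(2) by simp
    finally show ?thesis using pq(3) V(2) by simp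
  qed
  moreover have "w i = z1 i" if "n \<le> i" for i using that w z1(1) Zn by (auto simp: cspace_def)
  ultimately have "w = z1" by (intro ext) (meson leI)
  thus ?thesis using z1(1) by simp
qed

section \<open>Hamiltonian flows of the generators of a Poisson CGL extension\<close>

lemma poisson_algebra_const: "poisson_algebra S A br \<Longrightarrow> (\<lambda>_. c) \<in> A"
  unfolding poisson_algebra_def function_algebra_def by (elim conjE) (erule spec)

lemma poisson_algebra_cong:
  assumes "poisson_algebra S A br" and in_A: "f \<in> A" "f' \<in> A" "g \<in> A" "g' \<in> A"
    and eq: "feq S f f'" "feq S g g'" and x: "x \<in> S"
  shows "br f g x = br f' g' x"
proof -
  have "\<forall>f\<in>A. \<forall>f'\<in>A. \<forall>g\<in>A. \<forall>g'\<in>A. feq S f f' \<and> feq S g g' \<longrightarrow> feq S (br f g) (br f' g')"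
    using assms(1) unfolding poisson_algebra_def by (elim conjE)
  from this[rule_format, OF in_A conjI[OF eq]] show ?thesis using x by (simp add: feq_def)
qed

lemma poisson_algebra_antisym:
  assumes "poisson_algebra S A br" and in_A: "f \<in> A" "g \<in> A" and x: "x \<in> S"
  shows "br f g x = - br g f x"
proof -
  have "\<forall>f\<in>A. \<forall>g\<in>A. feq S (br f g) (\<lambda>x. - br g f x)"
    using assms(1) unfolding poisson_algebra_def by (elim conjE)
  from this[rule_format, OF in_A] show ?thesis unfolding feq_def using x by (rule bspec)
qed

lemma poisson_algebra_linear:
  assumes "poisson_algebra S A br" and in_A: "f \<in> A" "g \<in> A" "k \<in> A" and x: "x \<in> S"
  shows "br k (\<lambda>x. a * f x + b * g x) x = a * br k f x + b * br k g x"
proof -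
  have "\<forall>f\<in>A. \<forall>g\<in>A. \<forall>k\<in>A. \<forall>a b.
      feq S (br k (\<lambda>x. a * f x + b * g x)) (\<lambda>x. a * br k f x + b * br k g x)"
    using assms(1) unfolding poisson_algebra_def by (elim conjE)
  from this[rule_format, OF in_A] show ?thesis unfolding feq_def using x by (rule bspec)
qed

lemma poisson_algebra_mult:
  assumes "poisson_algebra S A br" and in_A: "f \<in> A" "g \<in> A" "k \<in> A" and x: "x \<in> S"
  shows "br k (\<lambda>x. f x * g x) x = br k f x * g x + f x * br k g x"
proof -
  have "\<forall>f\<in>A. \<forall>g\<in>A. \<forall>k\<in>A.
      feq S (br k (\<lambda>x. f x * g x)) (\<lambda>x. br k f x * g x + f x * br k g x)"
    using assms(1) unfolding poisson_algebra_def by (elim conjE)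
  from this[rule_format, OF in_A] show ?thesis unfolding feq_def using x by (rule bspec)
qed

lemma poisson_algebra_bracket_const:
  assumes P: "poisson_algebra S A br" and "k \<in> A" "x \<in> S"
  shows "br k (\<lambda>_. c) x = 0"
proof -
  note one = poisson_algebra_const[OF P, of 1]
  have "br k (\<lambda>_. 1) x = 0"
    using poisson_algebra_mult[OF P one one assms(2,3)] by simp
  thus ?thesis using poisson_algebra_linear[OF P one one assms(2,3), of c 0] by simp
qed

lemma poisson_algebra_bracket_add:
  assumes P: "poisson_algebra S A br" and "f \<in> A" "g \<in> A" "k \<in> A" "x \<in> S"
  shows "br k (\<lambda>x. f x + g x) x = br k f x + br k g x"
  using poisson_algebra_linear[OF assms, of 1 1] by simp

text \<open>A curve along which the coordinates have the derivatives prescribed by the Hamiltonian vector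
  field of \<open>f\<close> is an integral curve.\<close>

lemma polys_curve_derivative:
  assumes P: "poisson_algebra S A br" and A: "polys {..<n} \<subseteq> A" and f: "f \<in> A" and c: "x c \<in> S"
    and x: "\<And>k. k < n \<Longrightarrow> ((\<lambda>s. x s k) has_field_derivative br f (\<lambda>z. z k) (x c)) (at c)"
    and p: "p \<in> polys {..<n}"
  shows "((\<lambda>s. p (x s)) has_field_derivative br f p (x c)) (at c)"
  using p
proof induction
  case (const b)
  show ?case using poisson_algebra_bracket_const[OF P f c] by simp
next
  case (var i)
  thus ?case using x by simp
next
  case (add p q)
  hence "p \<in> A" "q \<in> A" using A by blast+
  from poisson_algebra_bracket_add[OF P this f c] show ?case
    using DERIV_add[OF add.IH] by simp
next
  case (mult p q)
  hence "p \<in> A" "q \<in> A" using A by blast+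
  from poisson_algebra_mult[OF P this f c] show ?case
    using DERIV_mult[OF mult.IH] by (simp add: algebra_simps)
qed

lemma localization_curve_derivative:
  assumes P: "poisson_algebra Z A br" and A: "polys {..<n} \<subseteq> A" and f: "f \<in> A"
    and D: "open D" "c \<in> D" "\<And>s. s \<in> D \<Longrightarrow> x s \<in> Z"
    and x: "\<And>k. k < n \<Longrightarrow> ((\<lambda>s. x s k) has_field_derivative br f (\<lambda>z. z k) (x c)) (at c)"
    and ys: "\<And>y. y \<in> set ys \<Longrightarrow> y \<in> polys {..<n}"
    and ysZ: "\<And>y z. y \<in> set ys \<Longrightarrow> z \<in> Z \<Longrightarrow> y z \<noteq> 0"
    and h: "h \<in> A" "h \<in> localization n ys Z"
  shows "((\<lambda>s. h (x s)) has_field_derivative br f h (x c)) (at c)"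
proof -
  obtain p a where p: "p \<in> polys {..<n}" "feq Z h (\<lambda>z. p z / (\<Prod>i<length ys. (ys ! i) z ^ a i))"
    using h(2) unfolding localization_def by blast
  define q where "q = (\<lambda>z. \<Prod>i<length ys. (ys ! i) z ^ a i)"
  have q: "q \<in> polys {..<n}" unfolding q_def using ys by (intro polys_prod polys_power) auto
  have qZ: "q z \<noteq> 0" if "z \<in> Z" for z unfolding q_def using ysZ that by auto
  have hq: "h z = p z / q z" if "z \<in> Z" for z using p(2) that by (simp add: feq_def q_def)
  have xc: "x c \<in> Z" using D by blast
  have in_A: "p \<in> A" "q \<in> A" "(\<lambda>z. h z * q z) \<in> A"
    using A p(1) q h(1) P by (auto simp: poisson_algebra_def function_algebra_def)
  have "br f p (x c) = br f (\<lambda>z. h z * q z) (x c)"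
    by (rule poisson_algebra_cong[OF P f f in_A(1,3) _ _ xc]) (auto simp: feq_def hq qZ)
  also have "\<dots> = br f h (x c) * q (x c) + h (x c) * br f q (x c)"
    by (rule poisson_algebra_mult[OF P h(1) in_A(2) f xc])
  finally have brp: "br f p (x c) = br f h (x c) * q (x c) + h (x c) * br f q (x c)" .
  have along: "((\<lambda>s. r (x s)) has_field_derivative br f r (x c)) (at c)" if "r \<in> polys {..<n}" for r
  proof (rule polys_curve_derivative[where br = br and f = f and p = r and x = x and c = c])
    show "((\<lambda>s. x s k) has_field_derivative br f (\<lambda>z. z k) (x c)) (at c)" if "k < n" for k
      by (rule x[OF that])
  qed (rule P A f xc that)+
  have "((\<lambda>s. p (x s) / q (x s)) has_field_derivative
      (br f p (x c) * q (x c) - p (x c) * br f q (x c)) / (q (x c) * q (x c))) (at c)"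
    by (rule DERIV_divide[OF along[OF p(1)] along[OF q] qZ[OF xc]])
  moreover have "(br f p (x c) * q (x c) - p (x c) * br f q (x c)) / (q (x c) * q (x c)) = br f h (x c)"
    using qZ[OF xc] unfolding brp hq[OF xc] by (simp add: field_simps)
  ultimately have "((\<lambda>s. p (x s) / q (x s)) has_field_derivative br f h (x c)) (at c)" by simp
  thus ?thesis
    by (rule has_field_derivative_transform_within_open[OF _ D(1,2)]) (use hq D(3) in auto)
qed

text \<open>In the Hamiltonian vector field of \<open>z j\<close> the component of \<open>z k\<close> is affine in \<open>z k\<close>, the
  other variables that it involves, apart from \<open>z j\<close>, have their index strictly between \<open>j\<close> and
  \<open>k\<close>, and \<open>z j\<close> itself is constant. So the system is triangular for the rank \<open>\<bar>i - j\<bar>\<close>, spelled out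
  on natural numbers.\<close>

definition index_dist :: "nat \<Rightarrow> nat \<Rightarrow> nat" where
  "index_dist j i = (if i < j then j - i else i - j)"

lemma symmetric_CGL_hamiltonian_field:
  assumes CGL: "symmetric_CGL n d R (\<xi>, h, h')" and j: "j < n"
  obtains a g where
    "\<And>k. k < n \<Longrightarrow> g k \<in> polys {i. i < n \<and> index_dist j i < index_dist j k}"
    "\<And>k z. k < n \<Longrightarrow> brk R (\<lambda>z. z j) (\<lambda>z. z k) z = a k * z j * z k + g k z"
    "a j = 0" "\<And>z. g j z = 0"
proof -
  let ?I = "\<lambda>k. {i. i < n \<and> index_dist j i < index_dist j k}"
  have P: "poisson_algebra UNIV (polys {..<n}) (brk R)"
    using CGL by (auto simp: symmetric_CGL_def T_poisson_algebra_def)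
  have antisym: "brk R (\<lambda>z. z i) (\<lambda>z. z k) z = - brk R (\<lambda>z. z k) (\<lambda>z. z i) z" if "i < n" "k < n" for i k z
    using that by (intro poisson_algebra_antisym[OF P]) (auto intro: polys.var)
  have rel: "\<exists>f\<in>polys {i<..<k}.
      brk R (\<lambda>z. z i) (\<lambda>z. z k) = (\<lambda>z. - char_pairing d (\<xi> i) (h k) * z i * z k - f z) \<and>
      brk R (\<lambda>z. z i) (\<lambda>z. z k) = (\<lambda>z. char_pairing d (\<xi> k) (h' i) * z i * z k - f z)"
    if "i < k" "k < n" for i k
    using CGL that unfolding symmetric_CGL_def by auto
  define \<Phi> where "\<Phi> k b f \<longleftrightarrow> f \<in> polys (?I k) \<and>
      (\<forall>z. brk R (\<lambda>z. z j) (\<lambda>z. z k) z = b * z j * z k + f z) \<and> (k = j \<longrightarrow> b = 0 \<and> f = (\<lambda>_. 0))"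
    for k b f
  have "\<exists>b f. \<Phi> k b f" if k: "k < n" for k
  proof -
    consider "k < j" | "k = j" | "j < k" by linarith
    thus ?thesis
    proof cases
      case 1
      obtain f where f: "f \<in> polys {k<..<j}"
        "brk R (\<lambda>z. z k) (\<lambda>z. z j) = (\<lambda>z. char_pairing d (\<xi> j) (h' k) * z k * z j - f z)"
        using rel[OF 1 j] by blast
      have "f \<in> polys (?I k)" using f(1) 1 j by (elim polys_mono) (auto simp: index_dist_def)
      moreover have "brk R (\<lambda>z. z j) (\<lambda>z. z k) z = - char_pairing d (\<xi> j) (h' k) * z j * z k + f z" for z
        using antisym[OF j k, of z] unfolding f(2) by simp
      ultimately have "\<Phi> k (- char_pairing d (\<xi> j) (h' k)) f" using 1 by (simp add: \<Phi>_def)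
      thus ?thesis by blast
    next
      case 2
      have "brk R (\<lambda>z. z j) (\<lambda>z. z j) z = 0" for z using antisym[OF j j, of z] by simp
      hence "\<Phi> k 0 (\<lambda>_. 0)" using 2 polys.const[of 0] by (simp add: \<Phi>_def)
      thus ?thesis by blast
    next
      case 3
      obtain f where f: "f \<in> polys {j<..<k}"
        "brk R (\<lambda>z. z j) (\<lambda>z. z k) = (\<lambda>z. - char_pairing d (\<xi> j) (h k) * z j * z k - f z)"
        using rel[OF 3 k] by blast
      have "(\<lambda>z. (- 1) * f z) \<in> polys {j<..<k}" by (intro polys.mult polys.const f(1))
      hence "(\<lambda>z. (- 1) * f z) \<in> polys (?I k)" using 3 k by (elim polys_mono) (auto simp: index_dist_def)
      moreover have "brk R (\<lambda>z. z j) (\<lambda>z. z k) z =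
          - char_pairing d (\<xi> j) (h k) * z j * z k + (- 1) * f z" for z
        unfolding f(2) by simp
      ultimately have "\<Phi> k (- char_pairing d (\<xi> j) (h k)) (\<lambda>z. (- 1) * f z)"
        using 3 by (simp add: \<Phi>_def)
      thus ?thesis by blast
    qed
  qed
  then obtain a g where ag: "\<And>k. k < n \<Longrightarrow> \<Phi> k (a k) (g k)" by metis
  show thesis
  proof (rule that[of g a])
    show "g k \<in> polys (?I k)" if "k < n" for k using ag[OF that] by (simp add: \<Phi>_def)
    show "brk R (\<lambda>z. z j) (\<lambda>z. z k) z = a k * z j * z k + g k z" if "k < n" for k z
      using ag[OF that] by (simp add: \<Phi>_def)
    show "a j = 0" "g j z = 0" for z using ag[OF j] by (simp_all add: \<Phi>_def)
  qed
qed

lemma symmetric_CGL_flow: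
  assumes CGL: "symmetric_CGL n d R (\<xi>, h, h')" and j: "j < n" and b: "b \<in> cspace n"
  obtains x where "x c0 = b" "\<And>c. x c \<in> cspace n"
    "\<And>k. k < n \<Longrightarrow> (\<lambda>c. x c k) \<in> quasi_polynomials"
    "\<And>k c. k < n \<Longrightarrow>
       ((\<lambda>s. x s k) has_field_derivative brk R (\<lambda>z. z j) (\<lambda>z. z k) (x c)) (at c)"
proof -
  obtain a g where g: "\<And>k. k < n \<Longrightarrow> g k \<in> polys {i. i < n \<and> index_dist j i < index_dist j k}"
    and field: "\<And>k z. k < n \<Longrightarrow> brk R (\<lambda>z. z j) (\<lambda>z. z k) z = a k * z j * z k + g k z"
    and aj: "a j = 0" and gj: "\<And>z. g j z = 0"
    by (rule symmetric_CGL_hamiltonian_field[OF CGL j]) (rule that)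
  \<comment> \<open>The \<open>j\<close>-th coordinate stays equal to \<open>b j\<close>, so the equations are linear with constant
    coefficients \<open>a k * b j\<close>.\<close>
  obtain x where x: "\<And>k. k < n \<Longrightarrow> (\<lambda>c. x c k) \<in> quasi_polynomials" "\<And>k. x c0 k = b k"
      "\<And>k c. n \<le> k \<Longrightarrow> x c k = b k"
      "\<And>k c. k < n \<Longrightarrow> ((\<lambda>c. x c k) has_field_derivative (a k * b j) * x c k + g k (x c)) (at c)"
    by (rule triangular_ode_solution[where n = n and g = g and ?c0.0 = c0 and b = b and
          \<alpha> = "\<lambda>k. a k * b j", OF g]) (assumption, rule that)
  have xj: "x c j = b j" for c
    unfolding x(2)[of j, symmetric]
    by (rule deriv_zero_imp_eq[where D = UNIV and f = "\<lambda>c. x c j"])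
       (use x(4)[OF j] in \<open>simp_all add: aj gj connected_UNIV\<close>)
  show thesis
  proof
    show "x c0 = b" using x(2) by (rule ext)
    show "x c \<in> cspace n" for c using b x(3) by (simp add: cspace_def)
    show "((\<lambda>s. x s k) has_field_derivative brk R (\<lambda>z. z j) (\<lambda>z. z k) (x c)) (at c)" if "k < n" for k c
      using x(4)[OF that, of c] unfolding field[OF that] xj by (simp add: mult_ac)
  qed (rule x(1))
qed

lemma symmetric_CGL_flow_unique:
  assumes CGL: "symmetric_CGL n d R (\<xi>, h, h')" and j: "j < n"
    and D: "open D" "connected D" "c0 \<in> D" "c \<in> D"
    and eq: "x c0 = y c0" and xn: "x c \<in> cspace n" and yn: "y c \<in> cspace n"
    and x: "\<And>k c. k < n \<Longrightarrow> c \<in> D \<Longrightarrow>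
       ((\<lambda>s. x s k) has_field_derivative brk R (\<lambda>z. z j) (\<lambda>z. z k) (x c)) (at c)"
    and y: "\<And>k c. k < n \<Longrightarrow> c \<in> D \<Longrightarrow>
       ((\<lambda>s. y s k) has_field_derivative brk R (\<lambda>z. z j) (\<lambda>z. z k) (y c)) (at c)"
  shows "x c = y c"
proof
  fix k
  obtain a g where g: "\<And>k. k < n \<Longrightarrow> g k \<in> polys {i. i < n \<and> index_dist j i < index_dist j k}"
    and field: "\<And>k z. k < n \<Longrightarrow> brk R (\<lambda>z. z j) (\<lambda>z. z k) z = a k * z j * z k + g k z"
    and aj: "a j = 0" and gj: "\<And>z. g j z = 0"
    by (rule symmetric_CGL_hamiltonian_field[OF CGL j]) (rule that)
  have linear: "((\<lambda>s. u s k) has_field_derivative (a k * u c0 j) * u c k + g k (u c)) (at c)"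
    if u: "\<And>k c. k < n \<Longrightarrow> c \<in> D \<Longrightarrow>
       ((\<lambda>s. u s k) has_field_derivative brk R (\<lambda>z. z j) (\<lambda>z. z k) (u c)) (at c)"
      and k: "k < n" "c \<in> D" for u k c
  proof -
    have "u c j = u c0 j"
      by (rule deriv_zero_imp_eq[where f = "\<lambda>c. u c j", OF D(1,2) _ k(2) D(3)])
         (use u[OF j] in \<open>simp add: field[OF j] aj gj\<close>)
    thus ?thesis using u[OF k] unfolding field[OF k(1)] by (simp add: mult_ac)
  qed
  show "x c k = y c k"
  proof (cases "k < n")
    case True
    show ?thesis
    proof (rule triangular_ode_unique[where x = x and y = y, OF g D(1-3) _ _ _ True D(4)])
      show "((\<lambda>c. x c k) has_field_derivative (a k * x c0 j) * x c k + g k (x c)) (at c)"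
        if "k < n" "c \<in> D" for k c by (rule linear[OF x that])
      show "((\<lambda>c. y c k) has_field_derivative (a k * x c0 j) * y c k + g k (y c)) (at c)"
        if "k < n" "c \<in> D" for k c unfolding eq by (rule linear[OF y that])
    qed (simp_all add: eq)
  qed (use xn yn in \<open>simp add: cspace_def\<close>)
qed

text \<open>Since \<open>{y, z j} = y * g\<close> with a polynomial \<open>g\<close>, the restriction \<open>u\<close> of \<open>y\<close> to the flow line satisfies
  \<open>u' = u * v\<close>, where \<open>v\<close> is the restriction of \<open>- g\<close>; both are
  quasi-polynomials.\<close>

lemma poisson_prime_along_flow:
  assumes CGL: "symmetric_CGL n d R (\<xi>, h, h')" and j: "j < n"
    and y: "homogeneous_poisson_prime n d R y"
    and xQ: "\<And>k. k < n \<Longrightarrow> (\<lambda>c. x c k) \<in> quasi_polynomials"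
    and x: "\<And>k c. k < n \<Longrightarrow>
       ((\<lambda>s. x s k) has_field_derivative brk R (\<lambda>z. z j) (\<lambda>z. z k) (x c)) (at c)"
    and c0: "y (x c0) \<noteq> 0"
  shows "(\<forall>c. y (x c) \<noteq> 0) \<and> (\<lambda>c. inverse (y (x c))) \<in> quasi_polynomials"
proof -
  have P: "poisson_algebra UNIV (polys {..<n}) (brk R)"
    using CGL by (auto simp: symmetric_CGL_def T_poisson_algebra_def)
  have zj: "(\<lambda>z. z j) \<in> polys {..<n}" using j by (auto intro: polys.var)
  have yp: "y \<in> polys {..<n}" using y by (simp add: homogeneous_poisson_prime_def)
  obtain g where g: "g \<in> polys {..<n}" "brk R y (\<lambda>z. z j) = (\<lambda>z. y z * g z)"
    using y zj unfolding homogeneous_poisson_prime_def by blast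
  have Q: "(\<lambda>c. p (x c)) \<in> quasi_polynomials" if "p \<in> polys {..<n}" for p
    by (rule polys_comp_quasi_polynomials[OF that]) (use xQ in simp)
  have along: "((\<lambda>s. y (x s)) has_field_derivative brk R (\<lambda>z. z j) y (x c)) (at c)" for c
  proof (rule polys_curve_derivative[where br = "brk R" and f = "\<lambda>z. z j" and p = y and x = x and c = c])
    show "((\<lambda>s. x s k) has_field_derivative brk R (\<lambda>z. z j) (\<lambda>z. z k) (x c)) (at c)" if "k < n" for k
      by (rule x[OF that])
  qed (rule P order_refl zj UNIV_I yp)+
  have "((\<lambda>s. y (x s)) has_field_derivative y (x c) * - g (x c)) (at c)" for c
  proof -
    have "brk R (\<lambda>z. z j) y (x c) = y (x c) * - g (x c)"
      using poisson_algebra_antisym[OF P zj yp, of "x c"] unfolding g(2) by simp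
    from along[of c, unfolded this] show ?thesis .
  qed
  thus ?thesis
    using quasi_polynomials_zero_free[where ?c0.0 = c0, OF Q[OF yp] quasi_polynomials_uminus[OF Q[OF g(1)]]] c0
    by blast
qed

section \<open>Localized extensions and charts\<close>

lemma polys_subset_localization: "polys {..<n} \<subseteq> localization n ys Z"
proof
  fix p :: "(nat \<Rightarrow> complex) \<Rightarrow> complex" assume "p \<in> polys {..<n}"
  moreover have "feq Z p (\<lambda>z. p z / (\<Prod>i<length ys. (ys ! i) z ^ 0))" by (simp add: feq_def)
  ultimately show "p \<in> localization n ys Z"
    unfolding localization_def by (intro CollectI bexI[of _ p] exI[of _ "\<lambda>_. 0"])
qed

lemma localized_symmetric_CGL_base:
  assumes "localized_symmetric_CGL n d R (\<xi>, h, h')"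
  shows "\<exists>R0 ys. symmetric_CGL n d R0 (\<xi>, h, h') \<and>
    (\<forall>y\<in>set ys. homogeneous_poisson_prime n d R0 y \<and> (\<forall>z\<in>pts R. y z \<noteq> 0)) \<and>
    elts R = localization n ys (pts R) \<and>
    (\<forall>p\<in>polys {..<n}. \<forall>q\<in>polys {..<n}. feq (pts R) (brk R p q) (brk R0 p q))"
  using assms unfolding localized_symmetric_CGL_def prod.case by (elim conjE)

text \<open>The flow of a generator on affine space preserves the affine open set \<open>Z = pts R\<close>: along it the
  denominators have no zeros, and \<open>Z\<close> contains all points at which they do not vanish.\<close>

lemma localized_CGL_flow:
  assumes CGL: "localized_symmetric_CGL n d R (\<xi>, h, h')" and j: "j < n"
    and R: "elts R = reg (affine_space n) (pts R)"
    and aff: "affine_variety (sub_fspace (affine_space n) (pts R))" and b: "b \<in> pts R"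
  obtains x where "x c0 = b" "\<And>c. x c \<in> pts R"
    "\<And>g. g \<in> elts R \<Longrightarrow> (\<lambda>c. g (x c)) \<in> quasi_polynomials"
    "\<And>g c. g \<in> elts R \<Longrightarrow>
       ((\<lambda>s. g (x s)) has_field_derivative brk R (\<lambda>z. z j) g (x c)) (at c)"
proof -
  let ?Z = "pts R"
  have Z: "openin (zariski n) ?Z" "?Z \<noteq> {}" and P: "poisson_algebra ?Z (elts R) (brk R)"
    using CGL by (auto simp: localized_symmetric_CGL_def T_poisson_algebra_def)
  obtain R0 ys where CGL0: "symmetric_CGL n d R0 (\<xi>, h, h')"
    and ys0: "\<forall>y\<in>set ys. homogeneous_poisson_prime n d R0 y \<and> (\<forall>z\<in>?Z. y z \<noteq> 0)"
    and loc: "elts R = localization n ys ?Z"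
    and brk0: "\<forall>p\<in>polys {..<n}. \<forall>q\<in>polys {..<n}. feq ?Z (brk R p q) (brk R0 p q)"
    using localized_symmetric_CGL_base[OF CGL] by blast
  have ys: "homogeneous_poisson_prime n d R0 y" if "y \<in> set ys" for y using ys0 that by blast
  have ysZ: "y z \<noteq> 0" if "y \<in> set ys" "z \<in> ?Z" for y z using ys0 that by blast
  have brk: "brk R p q z = brk R0 p q z"
    if "p \<in> polys {..<n}" "q \<in> polys {..<n}" "z \<in> ?Z" for p q z
    using brk0[rule_format, OF that(1,2)] that(3) by (simp add: feq_def)
  have ysp: "y \<in> polys {..<n}" if "y \<in> set ys" for y
    using ys[OF that] by (simp add: homogeneous_poisson_prime_def)
  have zk: "(\<lambda>z. z k) \<in> polys {..<n}" if "k < n" for k using that by (auto intro: polys.var)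
  have pA: "polys {..<n} \<subseteq> elts R" unfolding loc by (rule polys_subset_localization)
  have "b \<in> cspace n" using b openin_subset[OF Z(1)] by (auto simp: topspace_zariski)
  then obtain x where x: "x c0 = b" "\<And>c. x c \<in> cspace n"
    "\<And>k. k < n \<Longrightarrow> (\<lambda>c. x c k) \<in> quasi_polynomials"
    "\<And>k c. k < n \<Longrightarrow>
       ((\<lambda>s. x s k) has_field_derivative brk R0 (\<lambda>z. z j) (\<lambda>z. z k) (x c)) (at c)"
    by (rule symmetric_CGL_flow[OF CGL0 j, where ?c0.0 = c0]) (rule that)
  have y: "(\<forall>c. y (x c) \<noteq> 0) \<and> (\<lambda>c. inverse (y (x c))) \<in> quasi_polynomials" if "y \<in> set ys" for y
  proof (rule poisson_prime_along_flow[where x = x and ?c0.0 = c0])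
    show "y (x c0) \<noteq> 0" using ysZ[OF that b] x(1) by simp
  qed (rule CGL0 j ys[OF that] x(3,4) | assumption)+
  have xZ: "x c \<in> ?Z" for c
  proof (rule affine_open_contains_nonvanishing[OF Z aff, where ys = ys])
    show "reg (affine_space n) ?Z \<subseteq> localization n ys ?Z" using R loc by simp
    show "y \<in> polys {..<n} \<and> y (x c) \<noteq> 0" if "y \<in> set ys" for y
      using ysp[OF that] y[OF that] by simp
    show "y z \<noteq> 0" if "y \<in> set ys" "z \<in> ?Z" for y z by (rule ysZ[OF that])
  qed (rule x(2))
  show thesis
  proof
    show "x c0 = b" by (rule x(1))
    show "x c \<in> ?Z" for c by (rule xZ)
    fix g assume g: "g \<in> elts R"
    obtain p a where p: "p \<in> polys {..<n}" "feq ?Z g (\<lambda>z. p z / (\<Prod>i<length ys. (ys ! i) z ^ a i))"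
      using g unfolding loc localization_def by blast
    have "g (x c) = p (x c) * (\<Prod>i<length ys. inverse ((ys ! i) (x c)) ^ a i)" for c
      using p(2) xZ[of c]
      by (simp add: feq_def divide_inverse power_inverse prod_inversef[symmetric] comp_def)
    moreover have "(\<lambda>c. p (x c) * (\<Prod>i<length ys. inverse ((ys ! i) (x c)) ^ a i)) \<in> quasi_polynomials"
    proof (intro quasi_polynomials_mult quasi_polynomials_prod quasi_polynomials_power)
      show "(\<lambda>c. p (x c)) \<in> quasi_polynomials"
        by (rule polys_comp_quasi_polynomials[OF p(1)]) (use x(3) in simp)
      show "(\<lambda>c. inverse ((ys ! i) (x c))) \<in> quasi_polynomials" if "i \<in> {..<length ys}" for i
        using y[of "ys ! i"] that by simp
    qed
    ultimately show "(\<lambda>c. g (x c)) \<in> quasi_polynomials" by simp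
    show "((\<lambda>s. g (x s)) has_field_derivative brk R (\<lambda>z. z j) g (x c)) (at c)" for c
    proof (rule localization_curve_derivative[where Z = ?Z and A = "elts R" and br = "brk R"
          and f = "\<lambda>z. z j" and x = x and c = c and h = g and D = UNIV and ys = ys and n = n])
      show "((\<lambda>s. x s k) has_field_derivative brk R (\<lambda>z. z j) (\<lambda>z. z k) (x c)) (at c)" if "k < n" for k
        using x(4)[OF that, of c] unfolding brk[OF zk[OF j] zk[OF that] xZ] .
      show "(\<lambda>z. z j) \<in> elts R" using zk[OF j] pA by blast
      show "g \<in> localization n ys ?Z" using g loc by simp
      show "y \<in> polys {..<n}" if "y \<in> set ys" for y by (rule ysp[OF that])
      show "y z \<noteq> 0" if "y \<in> set ys" "z \<in> ?Z" for y z by (rule ysZ[OF that])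
    qed (rule P pA open_UNIV UNIV_I xZ g)+
  qed
qed

lemma localized_CGL_flow_unique:
  assumes CGL: "localized_symmetric_CGL n d R (\<xi>, h, h')" and j: "j < n"
    and D: "open D" "connected D" "c0 \<in> D" "c \<in> D" and eq: "x c0 = y c0"
    and xZ: "\<And>c. c \<in> D \<Longrightarrow> x c \<in> pts R" and yZ: "\<And>c. c \<in> D \<Longrightarrow> y c \<in> pts R"
    and x: "\<And>k c. k < n \<Longrightarrow> c \<in> D \<Longrightarrow>
       ((\<lambda>s. x s k) has_field_derivative brk R (\<lambda>z. z j) (\<lambda>z. z k) (x c)) (at c)"
    and y: "\<And>k c. k < n \<Longrightarrow> c \<in> D \<Longrightarrow>
       ((\<lambda>s. y s k) has_field_derivative brk R (\<lambda>z. z j) (\<lambda>z. z k) (y c)) (at c)"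
  shows "x c = y c"
proof -
  have "openin (zariski n) (pts R)" using CGL by (simp add: localized_symmetric_CGL_def)
  hence Zn: "pts R \<subseteq> cspace n" using openin_subset by (metis topspace_zariski)
  obtain R0 where CGL0: "symmetric_CGL n d R0 (\<xi>, h, h')"
    and brk0: "\<forall>p\<in>polys {..<n}. \<forall>q\<in>polys {..<n}. feq (pts R) (brk R p q) (brk R0 p q)"
    using localized_symmetric_CGL_base[OF CGL] by blast
  have brk: "brk R p q z = brk R0 p q z"
    if "p \<in> polys {..<n}" "q \<in> polys {..<n}" "z \<in> pts R" for p q z
    using brk0[rule_format, OF that(1,2)] that(3) by (simp add: feq_def)
  have zk: "(\<lambda>z. z k) \<in> polys {..<n}" if "k < n" for k using that by (auto intro: polys.var)
  show ?thesis
  proof (rule symmetric_CGL_flow_unique[where x = x and y = y, OF CGL0 j D eq])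
    show "x c \<in> cspace n" "y c \<in> cspace n" using xZ yZ D(4) Zn by blast+
    show "((\<lambda>s. x s k) has_field_derivative brk R0 (\<lambda>z. z j) (\<lambda>z. z k) (x c)) (at c)"
      if "k < n" "c \<in> D" for k c
      using x[OF that] unfolding brk[OF zk[OF j] zk[OF that(1)] xZ[OF that(2)]] .
    show "((\<lambda>s. y s k) has_field_derivative brk R0 (\<lambda>z. z j) (\<lambda>z. z k) (y c)) (at c)"
      if "k < n" "c \<in> D" for k c
      using y[OF that] unfolding brk[OF zk[OF j] zk[OF that(1)] yZ[OF that(2)]] .
  qed
qed

theorem theorem4p12:
  fixes X :: "'a fspace"
    and br :: "'a set \<Rightarrow> ('a \<Rightarrow> complex) \<Rightarrow> ('a \<Rightarrow> complex) \<Rightarrow> 'a \<Rightarrow> complex"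
    and \<A> :: "'a atlas"
    and n j :: nat
  assumes "poisson_ore_variety n X br \<A>"
    and "(Z, \<rho>) \<in> \<A>"
    and "j < n"
  shows "complete_hamiltonian_flow_Q (sub_fspace X (\<rho> ` Z)) (br (\<rho> ` Z)) (chart_coordinate Z \<rho> j)"
proof -
  note j = assms(3)
  obtain d act where TX: "T_poisson_variety d n X br act"
    and chart: "T_coordinate_chart d n X act Z \<rho>" and pres: "presented_in_chart d n X br act Z \<rho>"
    using assms(1,2) unfolding poisson_ore_variety_def T_poisson_ore_variety_def by blast
  let ?U = "\<rho> ` Z" and ?H = "br (\<rho> ` Z) (chart_coordinate Z \<rho> j)"
  let ?Y = "sub_fspace X ?U" and ?ZZ = "sub_fspace (affine_space n) Z"
  let ?P = "coordinate_T_poisson_algebra X br act ?U"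
  have Z: "openin (zariski n) Z" and aff: "affine_variety ?ZZ" and U: "openin (ztop X) ?U"
    and iso: "isomorphism ?ZZ ?Y \<rho>"
    using chart by (auto simp: T_coordinate_chart_def)
  note ptsZ = points_sub_affine_space[OF Z]
  have ptsY: "points ?Y = ?U" using openin_subset[OF U] by (auto simp: points_sub_fspace)
  have PX: "poisson_algebra ?U (reg X ?U) (br ?U)"
    using TX U by (simp add: T_poisson_variety_def poisson_structure_def)
  have "space_with_functions X" using TX by (simp add: T_poisson_variety_def variety_def)
  hence regY: "reg ?Y ?U = reg X ?U" using U by (rule space_with_functions_reg_sub)
  obtain \<psi> where iso': "isomorphism ?Y ?ZZ \<psi>" and \<psi>0: "\<forall>z\<in>points ?ZZ. \<psi> (\<rho> z) = z"
    using isomorphism_inverse[OF iso] by blast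
  have \<psi>: "\<psi> (\<rho> z) = z" if "z \<in> Z" for z using \<psi>0 that unfolding ptsZ by blast
  have inj: "inj_on \<rho> Z" using \<psi> by (metis inj_onI)
  obtain d' E D R where R: "pts R = Z" "elts R = reg (affine_space n) Z"
    and pr: "CGL_presentation d ?P d' n R D E (\<lambda>f. f \<circ> \<rho>)"
    using pres unfolding presented_in_chart_def by blast
  obtain \<xi> h h' where D: "D = (\<xi>, h, h')" by (cases D)
  have CGL: "localized_symmetric_CGL n d' R (\<xi>, h, h')"
    and I: "T_poisson_iso d ?P (R\<lparr>tact := tact R \<circ> E\<rparr>) (\<lambda>f. f \<circ> \<rho>)"
    using pr unfolding CGL_presentation_def D by auto
  have PR: "poisson_algebra Z (elts R) (brk R)"
    using CGL R(1) by (auto simp: localized_symmetric_CGL_def T_poisson_algebra_def)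
  have pull: "f \<circ> \<rho> \<in> elts R" if "f \<in> reg X ?U" for f
    using I that by (simp add: T_poisson_iso_def coordinate_T_poisson_algebra_def)
  have pull_brk: "br ?U f g (\<rho> z) = brk R (f \<circ> \<rho>) (g \<circ> \<rho>) z"
    if "f \<in> reg X ?U" "g \<in> reg X ?U" "z \<in> Z" for f g z
    using I that R(1) by (simp add: T_poisson_iso_def coordinate_T_poisson_algebra_def feq_def)
  have zk: "(\<lambda>z. z k) \<in> elts R" if "k < n" for k
    unfolding R(2) using that by (intro polys_in_reg_affine_space[OF Z] polys.var) simp
  have coord: "chart_coordinate Z \<rho> k (\<rho> z) = z k" if "z \<in> Z" for k z
    using inj that by (simp add: chart_coordinate_def)
  have coord_reg: "chart_coordinate Z \<rho> k \<in> reg X ?U" if k: "k < n" for k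
  proof -
    have "\<exists>f\<in>reg X ?U. feq Z (f \<circ> \<rho>) (\<lambda>z. z k)"
      using I zk[OF k] R(1) by (simp add: T_poisson_iso_def coordinate_T_poisson_algebra_def)
    then obtain f where f: "f \<in> reg X ?U" "feq Z (f \<circ> \<rho>) (\<lambda>z. z k)" by blast
    have "feq ?U f (chart_coordinate Z \<rho> k)" using f(2) coord by (auto simp: feq_def)
    moreover have "\<forall>f\<in>reg X ?U. \<forall>g. feq ?U f g \<longrightarrow> g \<in> reg X ?U"
      using PX unfolding poisson_algebra_def function_algebra_def by (elim conjE)
    ultimately show ?thesis using f(1) by blast
  qed
  \<comment> \<open>In the chart \<open>\<rho>\<close> the Hamiltonian vector field of the coordinate is that of \<open>z j\<close>.\<close>
  have H: "?H g (\<rho> z) = brk R (\<lambda>z. z j) (g \<circ> \<rho>) z" if g: "g \<in> reg X ?U" and z: "z \<in> Z" for g z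
  proof -
    have "?H g (\<rho> z) = brk R (chart_coordinate Z \<rho> j \<circ> \<rho>) (g \<circ> \<rho>) z"
      by (rule pull_brk[OF coord_reg[OF j] g z])
    also have "\<dots> = brk R (\<lambda>z. z j) (g \<circ> \<rho>) z"
      by (rule poisson_algebra_cong[OF PR pull[OF coord_reg[OF j]] zk[OF j] pull[OF g] pull[OF g] _ _ z])
         (simp_all add: feq_def coord)
    finally show ?thesis .
  qed
  have Hcoord: "?H (chart_coordinate Z \<rho> k) (\<rho> z) = brk R (\<lambda>z. z j) (\<lambda>z. z k) z"
    if k: "k < n" and z: "z \<in> Z" for k z
    unfolding H[OF coord_reg[OF k] z]
    by (rule poisson_algebra_cong[OF PR zk[OF j] zk[OF j] pull[OF coord_reg[OF k]] zk[OF k] _ _ z])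
       (simp_all add: feq_def coord)
  have flow: "\<exists>x. x c0 = b \<and> (\<forall>c. x c \<in> Z) \<and> integral_curve ?Y ?H UNIV (\<rho> \<circ> x) \<and> property_Q ?Y (\<rho> \<circ> x)"
    if b: "b \<in> Z" for b c0
  proof -
    obtain x where x: "x c0 = b" "\<And>c. x c \<in> Z"
      "\<And>g. g \<in> elts R \<Longrightarrow> (\<lambda>c. g (x c)) \<in> quasi_polynomials"
      "\<And>g c. g \<in> elts R \<Longrightarrow> ((\<lambda>s. g (x s)) has_field_derivative brk R (\<lambda>z. z j) g (x c)) (at c)"
      by (rule localized_CGL_flow[OF CGL j, unfolded R(1), OF R(2) aff b, where ?c0.0 = c0]) (rule that)
    have "integral_curve ?Y ?H UNIV (\<rho> \<circ> x)"
      unfolding integral_curve_def ptsY regY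
    proof (intro conjI ballI)
      show "(\<rho> \<circ> x) ` UNIV \<subseteq> ?U" using x(2) by auto
      show "((\<lambda>s. g ((\<rho> \<circ> x) s)) has_field_derivative ?H g ((\<rho> \<circ> x) c)) (at c)"
        if "g \<in> reg X ?U" for g c
        using x(4)[OF pull[OF that], of c] H[OF that x(2)] by simp
    qed
    moreover have "property_Q ?Y (\<rho> \<circ> x)"
    proof -
      obtain m \<phi> where emb: "closed_embedding ?ZZ (affine_space m) \<phi>"
        using aff unfolding affine_variety_def by blast
      have im: "(\<phi> \<circ> \<psi>) ` points ?Y = \<phi> ` points ?ZZ"
        unfolding ptsY ptsZ using \<psi> by (force simp: image_image)
      have "closed_embedding ?Y (affine_space m) (\<phi> \<circ> \<psi>)"
        using emb isomorphism_compose[OF iso'] unfolding closed_embedding_def im by blast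
      moreover have "(\<lambda>c. (\<phi> \<circ> \<psi>) ((\<rho> \<circ> x) c) l) \<in> quasi_polynomials" if "l < m" for l
        using x(3)[unfolded R(2), OF closed_embedding_coordinate_regular[OF Z emb that]] \<psi> x(2)
        by simp
      ultimately show ?thesis unfolding property_Q_def by blast
    qed
    ultimately show ?thesis using x(1,2) by blast
  qed
  show ?thesis
    unfolding complete_hamiltonian_flow_Q_def
  proof (intro conjI ballI allI impI)
    fix p assume "p \<in> points ?Y"
    then obtain b where b: "b \<in> Z" "p = \<rho> b" unfolding ptsY by blast
    show "\<exists>\<gamma>. integral_curve ?Y ?H UNIV \<gamma> \<and> \<gamma> 0 = p"
      using flow[OF b(1), of 0] b(2) by auto
  next
    \<comment> \<open>A given local integral curve coincides with the complete one through one of its points.\<close>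
    fix D \<gamma> assume "open D \<and> connected D \<and> D \<noteq> {} \<and> integral_curve ?Y ?H D \<gamma>"
    then obtain c0 where D: "open D" "connected D" "c0 \<in> D" and \<gamma>: "integral_curve ?Y ?H D \<gamma>"
      by blast
    have \<gamma>U: "\<gamma> c \<in> ?U" if "c \<in> D" for c using \<gamma> that unfolding integral_curve_def ptsY by blast
    have \<rho>\<psi>: "\<rho> (\<psi> p) = p" "\<psi> p \<in> Z" if "p \<in> ?U" for p using that \<psi> by auto
    define y where "y c = \<psi> (\<gamma> c)" for c
    have y: "y c \<in> Z" "\<rho> (y c) = \<gamma> c" if "c \<in> D" for c
      using \<rho>\<psi>[OF \<gamma>U[OF that]] by (simp_all add: y_def)
    obtain x where x: "x c0 = y c0" "\<And>c. x c \<in> Z" "integral_curve ?Y ?H UNIV (\<rho> \<circ> x)"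
      "property_Q ?Y (\<rho> \<circ> x)"
      using flow[OF y(1)[OF D(3)], of c0] by blast
    have along: "((\<lambda>s. u s k) has_field_derivative brk R (\<lambda>z. z j) (\<lambda>z. z k) (u c)) (at c)"
      if curve: "integral_curve ?Y ?H D \<delta>" and u: "\<And>c. c \<in> D \<Longrightarrow> u c \<in> Z \<and> \<delta> c = \<rho> (u c)"
        and k: "k < n" and c: "c \<in> D" for u \<delta> k c
    proof -
      have "((\<lambda>s. chart_coordinate Z \<rho> k (\<delta> s)) has_field_derivative
          ?H (chart_coordinate Z \<rho> k) (\<delta> c)) (at c)"
        using curve coord_reg[OF k] c unfolding integral_curve_def ptsY regY by blast
      hence "((\<lambda>s. chart_coordinate Z \<rho> k (\<delta> s)) has_field_derivative
          brk R (\<lambda>z. z j) (\<lambda>z. z k) (u c)) (at c)"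
        using u[OF c] Hcoord[OF k, of "u c"] by simp
      thus ?thesis
        by (rule has_field_derivative_transform_within_open[OF _ D(1) c]) (use u coord in simp)
    qed
    have "x c = y c" if "c \<in> D" for c
    proof (rule localized_CGL_flow_unique[where x = x and y = y, OF CGL j D that x(1)])
      show "x c \<in> pts R" "y c \<in> pts R" if "c \<in> D" for c using x(2) y(1)[OF that] R(1) by simp_all
      have "integral_curve ?Y ?H D (\<rho> \<circ> x)" using x(3) unfolding integral_curve_def by blast
      thus "((\<lambda>s. x s k) has_field_derivative brk R (\<lambda>z. z j) (\<lambda>z. z k) (x c)) (at c)"
        if "k < n" "c \<in> D" for k c
        by (rule along[OF _ _ that]) (simp add: x(2))
      show "((\<lambda>s. y s k) has_field_derivative brk R (\<lambda>z. z j) (\<lambda>z. z k) (y c)) (at c)"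
        if "k < n" "c \<in> D" for k c
        by (rule along[OF \<gamma> _ that]) (simp add: y)
    qed
    hence "\<forall>c\<in>D. (\<rho> \<circ> x) c = \<gamma> c" using y(2) by simp
    thus "\<exists>\<gamma>'. integral_curve ?Y ?H UNIV \<gamma>' \<and> (\<forall>c\<in>D. \<gamma>' c = \<gamma> c) \<and> property_Q ?Y \<gamma>'"
      using x(3,4) by blast
  qed
qed

end
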